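(* Let $p$ be a prime and let $R$ be a graded-commutative $\mathbb{Z}_p$-algebra equipped with an isomorphism $\zeta\colon R_d\to\mathbb{Q}_p/\mathbb{Z}_p$ for some integer $d$. If $R$ is Pontrjagin self-dual (with respect to $\zeta$), then $R$ is self-injective.
   Context: Rings are $\mathbb{Z}$-graded, unital and commutative in the graded sense: $ba=(-1)^{|a||b|}ab$; modules are graded. $\mathbb{Z}_p$ is the ring of $p$-adic integers. For a $\mathbb{Z}_p$-module $M$ the Pontrjagin dual is $M^\vee=\operatorname{Hom}_{\mathbb{Z}_p}(M,\mathbb{Q}_p/\mathbb{Z}_p)$. Given a graded $\mathbb{Z}_p$-algebra $R$ with a specified isomorphism $\zeta\colon R_d\to\mathbb{Q}_p/\mathbb{Z}_p$ (of $\mathbb{Z}_p$-modules), define maps $\zeta^\#\colon R_{d-k}\to R_k^\vee$ by $\zeta^\#(a)(b)=\zeta(ab)$, for all $k\in\mathbb{Z}$. $R$ is Pontrjagin self-dual if all these maps are isomorphisms. A graded ring $R$ is self-injective if $R$ is an injective object in the category of graded $R$-modules. *)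

theory Defs
  imports "HOL-Algebra.AbelCoset" "HOL-Algebra.Module" "HOL-Computational_Algebra.Primes"
begin

section \<open>Modules and homomorphisms\<close>

text \<open>The locale \<^locale>\<open>module\<close> asks for commutative scalars (in the ungraded sense); a
  graded-commutative ring is in general not commutative. Over a graded-commutative ring, graded left
  and right modules amount to the same thing via the sign rule, so we use left modules.

  In all records of type \<^typ>\<open>('a, 'b) module\<close> that are merely modules, the fields for
  multiplication and unit play no role; they are left \<^const>\<open>undefined\<close>.\<close>

locale left_module = R?: ring R + M?: abelian_group M
  for R :: "('a, 'r) ring_scheme" (structure) and M :: "('a, 'b, 'm) module_scheme" (structure) +
  assumes smult_closed:
      "\<lbrakk>a \<in> carrier R; x \<in> carrier M\<rbrakk> \<Longrightarrow> a \<odot>\<^bsub>M\<^esub> x \<in> carrier M"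
    and smult_l_distr:
      "\<lbrakk>a \<in> carrier R; b \<in> carrier R; x \<in> carrier M\<rbrakk> \<Longrightarrow>
      (a \<oplus>\<^bsub>R\<^esub> b) \<odot>\<^bsub>M\<^esub> x = a \<odot>\<^bsub>M\<^esub> x \<oplus>\<^bsub>M\<^esub> b \<odot>\<^bsub>M\<^esub> x"
    and smult_r_distr:
      "\<lbrakk>a \<in> carrier R; x \<in> carrier M; y \<in> carrier M\<rbrakk> \<Longrightarrow>
      a \<odot>\<^bsub>M\<^esub> (x \<oplus>\<^bsub>M\<^esub> y) = a \<odot>\<^bsub>M\<^esub> x \<oplus>\<^bsub>M\<^esub> a \<odot>\<^bsub>M\<^esub> y"
    and smult_assoc1:
      "\<lbrakk>a \<in> carrier R; b \<in> carrier R; x \<in> carrier M\<rbrakk> \<Longrightarrow>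
      (a \<otimes>\<^bsub>R\<^esub> b) \<odot>\<^bsub>M\<^esub> x = a \<odot>\<^bsub>M\<^esub> (b \<odot>\<^bsub>M\<^esub> x)"
    and smult_one:
      "x \<in> carrier M \<Longrightarrow> \<one>\<^bsub>R\<^esub> \<odot>\<^bsub>M\<^esub> x = x"

definition module_hom ::
  "('a, 'r) ring_scheme \<Rightarrow> ('a, 'b, 'm) module_scheme \<Rightarrow> ('a, 'c, 'n) module_scheme \<Rightarrow> ('b \<Rightarrow> 'c) set"
  where "module_hom R M N =
    {f \<in> hom (add_monoid M) (add_monoid N).
       \<forall>r \<in> carrier R. \<forall>x \<in> carrier M. f (r \<odot>\<^bsub>M\<^esub> x) = r \<odot>\<^bsub>N\<^esub> f x}"

definition module_iso ::
  "('a, 'r) ring_scheme \<Rightarrow> ('a, 'b, 'm) module_scheme \<Rightarrow> ('a, 'c, 'n) module_scheme \<Rightarrow> ('b \<Rightarrow> 'c) set"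
  where "module_iso R M N = {f \<in> module_hom R M N. bij_betw f (carrier M) (carrier N)}"

definition quotient_module :: "('a, 'b, 'm) module_scheme \<Rightarrow> 'b set \<Rightarrow> ('a, 'b set) module"
  where "quotient_module M N =
    \<lparr>carrier = a_rcosets\<^bsub>M\<^esub> N,
     monoid.mult = undefined, one = undefined,
     zero = N,
     add = (\<lambda>S T. S <+>\<^bsub>M\<^esub> T),
     smult = (\<lambda>c S. \<Union>x \<in> S. N +>\<^bsub>M\<^esub> (c \<odot>\<^bsub>M\<^esub> x))\<rparr>"


section \<open>The field of fractions of a domain\<close>

text \<open>The pair \<open>(a, b)\<close> stands for \<open>a / b\<close>. Operations on classes are unions over representatives, all
  of which give the same class. The result is a module over the base ring as well as a field.\<close>

definition frac_rel :: "('a, 'r) ring_scheme \<Rightarrow> (('a \<times> 'a) \<times> ('a \<times> 'a)) set"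
  where "frac_rel R =
    {((a, b), (c, d)). a \<in> carrier R \<and> b \<in> carrier R - {\<zero>\<^bsub>R\<^esub>} \<and>
       c \<in> carrier R \<and> d \<in> carrier R - {\<zero>\<^bsub>R\<^esub>} \<and> a \<otimes>\<^bsub>R\<^esub> d = c \<otimes>\<^bsub>R\<^esub> b}"

definition mk_frac :: "('a, 'r) ring_scheme \<Rightarrow> 'a \<Rightarrow> 'a \<Rightarrow> ('a \<times> 'a) set"
  where "mk_frac R a b = frac_rel R `` {(a, b)}"

definition fraction_field :: "('a, 'r) ring_scheme \<Rightarrow> ('a, ('a \<times> 'a) set) module"
  where "fraction_field R =
    \<lparr>carrier = (carrier R \<times> (carrier R - {\<zero>\<^bsub>R\<^esub>})) // frac_rel R,
     monoid.mult = (\<lambda>S T. \<Union>(a, b) \<in> S. \<Union>(c, d) \<in> T. mk_frac R (a \<otimes>\<^bsub>R\<^esub> c) (b \<otimes>\<^bsub>R\<^esub> d)),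
     one = mk_frac R \<one>\<^bsub>R\<^esub> \<one>\<^bsub>R\<^esub>,
     zero = mk_frac R \<zero>\<^bsub>R\<^esub> \<one>\<^bsub>R\<^esub>,
     add = (\<lambda>S T. \<Union>(a, b) \<in> S. \<Union>(c, d) \<in> T.
              mk_frac R (a \<otimes>\<^bsub>R\<^esub> d \<oplus>\<^bsub>R\<^esub> c \<otimes>\<^bsub>R\<^esub> b) (b \<otimes>\<^bsub>R\<^esub> d)),
     smult = (\<lambda>r S. \<Union>(a, b) \<in> S. mk_frac R (r \<otimes>\<^bsub>R\<^esub> a) b)\<rparr>"


section \<open>The p-adic integers, the p-adic numbers and their quotient\<close>

type_synonym padic_int = "nat \<Rightarrow> int"

text \<open>The inverse limit of the rings of integers modulo \<open>p ^ n\<close>, residue classes being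
  represented by their least nonnegative elements.\<close>

definition padic_integers :: "nat \<Rightarrow> padic_int ring"
  where "padic_integers p =
    \<lparr>carrier = {x. \<forall>n. x n \<in> {0..<int p ^ n} \<and> x (Suc n) mod int p ^ n = x n},
     monoid.mult = (\<lambda>x y n. (x n * y n) mod int p ^ n),
     one = (\<lambda>n. 1 mod int p ^ n),
     zero = (\<lambda>n. 0),
     add = (\<lambda>x y n. (x n + y n) mod int p ^ n)\<rparr>"

definition padic_numbers :: "nat \<Rightarrow> (padic_int, (padic_int \<times> padic_int) set) module"
  where "padic_numbers p = fraction_field (padic_integers p)"

definition Qp_mod_Zp :: "nat \<Rightarrow> (padic_int, (padic_int \<times> padic_int) set set) module"
  where "Qp_mod_Zp p =
    quotient_module (padic_numbers p)
      ((\<lambda>a. mk_frac (padic_integers p) a \<one>\<^bsub>padic_integers p\<^esub>) ` carrier (padic_integers p))"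

text \<open>Homomorphisms are made extensional, so that two of them are equal as soon as they agree on
  the module.\<close>

definition pontrjagin_dual ::
  "nat \<Rightarrow> (padic_int, 'b, 'm) module_scheme \<Rightarrow>
   (padic_int, 'b \<Rightarrow> (padic_int \<times> padic_int) set set) module"
  where "pontrjagin_dual p M =
    \<lparr>carrier = module_hom (padic_integers p) M (Qp_mod_Zp p) \<inter> extensional (carrier M),
     monoid.mult = undefined, one = undefined,
     zero = (\<lambda>x \<in> carrier M. \<zero>\<^bsub>Qp_mod_Zp p\<^esub>),
     add = (\<lambda>f g. \<lambda>x \<in> carrier M. f x \<oplus>\<^bsub>Qp_mod_Zp p\<^esub> g x),
     smult = (\<lambda>c f. \<lambda>x \<in> carrier M. c \<odot>\<^bsub>Qp_mod_Zp p\<^esub> f x)\<rparr>"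


section \<open>Graded rings and modules\<close>

text \<open>A grading is an internal direct sum decomposition of the additive group into subgroups
  indexed by the integers.\<close>

definition is_grading :: "('b, 'm) ring_scheme \<Rightarrow> (int \<Rightarrow> 'b set) \<Rightarrow> bool"
  where "is_grading M A \<longleftrightarrow>
    (\<forall>k. additive_subgroup (A k) M) \<and>
    (\<forall>x \<in> carrier M. \<exists>!c. (\<forall>k. c k \<in> A k) \<and> finite {k. c k \<noteq> \<zero>\<^bsub>M\<^esub>} \<and>
       x = (\<Oplus>\<^bsub>M\<^esub>k \<in> {k. c k \<noteq> \<zero>\<^bsub>M\<^esub>}. c k))"

locale graded_ring = ring R for R :: "('a, 'r) ring_scheme" (structure) and A :: "int \<Rightarrow> 'a set" +
  assumes grading: "is_grading R A"
    and one_degree: "\<one> \<in> A 0"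
    and mult_degree: "\<lbrakk>a \<in> A i; b \<in> A j\<rbrakk> \<Longrightarrow> a \<otimes> b \<in> A (i + j)"

locale graded_commutative_ring = graded_ring +
  assumes graded_commute:
    "\<lbrakk>a \<in> A i; b \<in> A j\<rbrakk> \<Longrightarrow> b \<otimes> a = (if even (i * j) then a \<otimes> b else \<ominus> (a \<otimes> b))"

locale graded_commutative_algebra =
  K?: module K R + graded_commutative_ring R A
  for K :: "('k, 'r) ring_scheme" and R :: "('k, 'a, 'm) module_scheme" (structure)
    and A :: "int \<Rightarrow> 'a set" +
  assumes smult_degree: "\<lbrakk>c \<in> carrier K; a \<in> A k\<rbrakk> \<Longrightarrow> c \<odot> a \<in> A k"
    and smult_mult_left:
      "\<lbrakk>c \<in> carrier K; a \<in> carrier R; b \<in> carrier R\<rbrakk> \<Longrightarrow> (c \<odot> a) \<otimes> b = c \<odot> (a \<otimes> b)"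
    and smult_mult_right:
      "\<lbrakk>c \<in> carrier K; a \<in> carrier R; b \<in> carrier R\<rbrakk> \<Longrightarrow> a \<otimes> (c \<odot> b) = c \<odot> (a \<otimes> b)"

locale graded_module =
  left_module R M + graded_ring R A
  for R :: "('a, 'r) ring_scheme" (structure) and A :: "int \<Rightarrow> 'a set"
    and M :: "('a, 'b, 'm) module_scheme" (structure) and B :: "int \<Rightarrow> 'b set" +
  assumes module_grading: "is_grading M B"
    and smult_degree: "\<lbrakk>a \<in> A i; x \<in> B j\<rbrakk> \<Longrightarrow> a \<odot>\<^bsub>M\<^esub> x \<in> B (i + j)"

definition graded_module_hom ::
  "('a, 'r) ring_scheme \<Rightarrow> ('a, 'b, 'm) module_scheme \<Rightarrow> (int \<Rightarrow> 'b set) \<Rightarrow>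
   ('a, 'c, 'n) module_scheme \<Rightarrow> (int \<Rightarrow> 'c set) \<Rightarrow> ('b \<Rightarrow> 'c) set"
  where "graded_module_hom R M B N C = {f \<in> module_hom R M N. \<forall>k. f ` B k \<subseteq> C k}"

definition regular_module :: "('a, 'r) ring_scheme \<Rightarrow> ('a, 'a) module"
  where "regular_module R =
    \<lparr>carrier = carrier R, monoid.mult = monoid.mult R, one = one R, zero = zero R, add = add R, smult = monoid.mult R\<rparr>"

text \<open>Injectivity in the category of graded modules and degree-preserving linear maps. A
  definition cannot quantify over types, hence the two type arguments, over which the test modules
  range; injectivity without restriction is the statement for all types \<open>'l\<close> and \<open>'m\<close>.\<close>

definition graded_injective ::
  "'l itself \<Rightarrow> 'm itself \<Rightarrow> ('a, 'r) ring_scheme \<Rightarrow> (int \<Rightarrow> 'a set) \<Rightarrow>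
   ('a, 'q) module \<Rightarrow> (int \<Rightarrow> 'q set) \<Rightarrow> bool"
  where "graded_injective _ _ R A Q C \<longleftrightarrow>
    graded_module R A Q C \<and>
    (\<forall>(L :: ('a, 'l) module) D (M :: ('a, 'm) module) E f g.
       graded_module R A L D \<and> graded_module R A M E \<and>
       f \<in> graded_module_hom R L D M E \<and> inj_on f (carrier L) \<and>
       g \<in> graded_module_hom R L D Q C \<longrightarrow>
       (\<exists>h \<in> graded_module_hom R M E Q C. \<forall>x \<in> carrier L. h (f x) = g x))"

definition self_injective ::
  "'l itself \<Rightarrow> 'm itself \<Rightarrow> ('a, 'r) ring_scheme \<Rightarrow> (int \<Rightarrow> 'a set) \<Rightarrow> bool"
  where "self_injective L M R A \<longleftrightarrow> graded_injective L M R A (regular_module R) A"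


section \<open>Pontrjagin self-duality\<close>

definition component :: "('k, 'a) module \<Rightarrow> (int \<Rightarrow> 'a set) \<Rightarrow> int \<Rightarrow> ('k, 'a) module"
  where "component R A k = R\<lparr>carrier := A k\<rparr>"

definition zeta_sharp ::
  "('k, 'a) module \<Rightarrow> (int \<Rightarrow> 'a set) \<Rightarrow> ('a \<Rightarrow> 'z) \<Rightarrow> int \<Rightarrow> 'a \<Rightarrow> 'a \<Rightarrow> 'z"
  where "zeta_sharp R A \<zeta> k a = (\<lambda>b \<in> A k. \<zeta> (a \<otimes>\<^bsub>R\<^esub> b))"

definition pontrjagin_self_dual ::
  "nat \<Rightarrow> (padic_int, 'a) module \<Rightarrow> (int \<Rightarrow> 'a set) \<Rightarrow> int \<Rightarrow>
   ('a \<Rightarrow> (padic_int \<times> padic_int) set set) \<Rightarrow> bool"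
  where "pontrjagin_self_dual p R A d \<zeta> \<longleftrightarrow>
    (\<forall>k. zeta_sharp R A \<zeta> k \<in>
       module_iso (padic_integers p) (component R A (d - k)) (pontrjagin_dual p (component R A k)))"

end

theory Submission
  imports Defs "HOL-Algebra.Ideal" "HOL-Number_Theory.Cong"
begin

text \<open>Over the principal ideal domain \<open>\<int>\<^sub>p\<close> the divisible module \<open>\<rat>\<^sub>p/\<int>\<^sub>p\<close> is injective, and
  coinduction carries injectivity from \<open>\<int>\<^sub>p\<close> to \<open>R\<close>. Self-duality says that \<open>R\<close> is, up to a shift
  of degree, the coinduced module with components \<open>Hom (R\<^sub>k, \<rat>\<^sub>p/\<int>\<^sub>p)\<close>. In concrete terms, a graded
  homomorphism \<open>h\<close> from \<open>M\<close> to \<open>R\<close> is the same thing as a \<open>\<int>\<^sub>p\<close>-linear functional \<open>\<phi>\<close> on the degree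
  \<open>d\<close> part of \<open>M\<close>: it is recovered from \<open>\<phi>\<close> by the rule that \<open>\<zeta> (b \<otimes> h x) = \<phi> (b x)\<close> for all \<open>b\<close>
  of the degree complementary to that of \<open>x\<close>. To extend a homomorphism from a submodule it is thus
  enough to extend a functional, and that is possible because \<open>\<rat>\<^sub>p/\<int>\<^sub>p\<close> is injective.

  As \<open>\<zeta>\<close> is an isomorphism, the degree \<open>d\<close> part \<open>A d\<close> of \<open>R\<close> can take the place of \<open>\<rat>\<^sub>p/\<int>\<^sub>p\<close>
  throughout: functionals take values in \<open>A d\<close>, and the only fact about \<open>\<rat>\<^sub>p/\<int>\<^sub>p\<close> that enters is
  its divisibility (\<open>Qp_mod_Zp_divisible\<close>). With \<open>padic_ideal_principal\<close> this makes
  \<open>A d\<close> injective (\<open>linear_graph_extends_to_hom\<close>). The correspondence between functionals and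
  homomorphisms is \<open>hom_from_functional\<close>; its construction is carried out on homogeneous elements and
  extended to sums by \<open>additive_family_extends\<close>.\<close>

section \<open>The p-adic integers form a principal ideal domain\<close>

lemma padic_simps:
  "x \<otimes>\<^bsub>padic_integers p\<^esub> y = (\<lambda>n. (x n * y n) mod int p ^ n)"
  "\<one>\<^bsub>padic_integers p\<^esub> = (\<lambda>n. 1 mod int p ^ n)"
  "\<zero>\<^bsub>padic_integers p\<^esub> = (\<lambda>n. 0)"
  "x \<oplus>\<^bsub>padic_integers p\<^esub> y = (\<lambda>n. (x n + y n) mod int p ^ n)"
  by (simp_all add: padic_integers_def)

lemma padic_carrier_iff:
  "x \<in> carrier (padic_integers p) \<longleftrightarrow>
    (\<forall>n. x n \<in> {0..<int p ^ n} \<and> x (Suc n) mod int p ^ n = x n)"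
  by (simp add: padic_integers_def)

lemma padic_digit_mod_self:
  assumes "x \<in> carrier (padic_integers p)"
  shows "x n mod int p ^ n = x n"
  using assms by (auto simp: padic_carrier_iff)

lemma padic_digit_mod:
  assumes x: "x \<in> carrier (padic_integers p)" and "m \<le> n"
  shows "x n mod int p ^ m = x m"
  using \<open>m \<le> n\<close>
proof (induction n rule: dec_induct)
  case base
  show ?case using x by (rule padic_digit_mod_self)
next
  case (step n)
  have "x (Suc n) mod int p ^ m = (x (Suc n) mod int p ^ n) mod int p ^ m"
    using step.hyps by (simp add: mod_mod_cancel le_imp_power_dvd)
  also have "x (Suc n) mod int p ^ n = x n" using x by (simp add: padic_carrier_iff)
  finally show ?case using step.IH by simp
qed

lemma padic_carrierI:
  assumes "0 < p" and "\<And>n. f (Suc n) mod int p ^ n = f n mod int p ^ n"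
  shows "(\<lambda>n. f n mod int p ^ n) \<in> carrier (padic_integers p)"
  using assms by (simp add: padic_carrier_iff mod_mod_cancel)

lemma padic_cring:
  assumes "0 < p"
  shows "cring (padic_integers p)"
proof (rule cringI)
  let ?Z = "padic_integers p"
  have digit: "x (Suc n) mod int p ^ n = x n mod int p ^ n" if "x \<in> carrier ?Z" for x n
    using padic_digit_mod[OF that, of n "Suc n"] padic_digit_mod_self[OF that] by simp
  show "abelian_group ?Z"
  proof (rule abelian_groupI)
    fix x y z assume x: "x \<in> carrier ?Z" and y: "y \<in> carrier ?Z" and z: "z \<in> carrier ?Z"
    show "x \<oplus>\<^bsub>?Z\<^esub> y \<in> carrier ?Z"
      unfolding padic_simps using digit[OF x] digit[OF y]
      by (intro padic_carrierI assms) (rule mod_add_cong)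
    show "x \<oplus>\<^bsub>?Z\<^esub> y \<oplus>\<^bsub>?Z\<^esub> z = x \<oplus>\<^bsub>?Z\<^esub> (y \<oplus>\<^bsub>?Z\<^esub> z)"
      by (simp add: padic_simps mod_simps add.assoc)
    show "x \<oplus>\<^bsub>?Z\<^esub> y = y \<oplus>\<^bsub>?Z\<^esub> x" by (simp add: padic_simps add.commute)
    show "\<zero>\<^bsub>?Z\<^esub> \<oplus>\<^bsub>?Z\<^esub> x = x" using x by (simp add: padic_simps padic_digit_mod_self)
    have "(\<lambda>n. (- x n) mod int p ^ n) \<in> carrier ?Z"
      using digit[OF x] by (intro padic_carrierI assms) (rule mod_minus_cong)
    moreover have "(\<lambda>n. (- x n) mod int p ^ n) \<oplus>\<^bsub>?Z\<^esub> x = \<zero>\<^bsub>?Z\<^esub>"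
      by (simp add: padic_simps mod_simps)
    ultimately show "\<exists>y \<in> carrier ?Z. y \<oplus>\<^bsub>?Z\<^esub> x = \<zero>\<^bsub>?Z\<^esub>"
      by (intro bexI[of _ "\<lambda>n. (- x n) mod int p ^ n"])
  next
    show "\<zero>\<^bsub>?Z\<^esub> \<in> carrier ?Z" using assms by (simp add: padic_carrier_iff padic_simps)
  qed
  show "comm_monoid ?Z"
  proof (rule comm_monoidI)
    fix x y z assume x: "x \<in> carrier ?Z" and y: "y \<in> carrier ?Z" and z: "z \<in> carrier ?Z"
    show "x \<otimes>\<^bsub>?Z\<^esub> y \<in> carrier ?Z"
      unfolding padic_simps using digit[OF x] digit[OF y]
      by (intro padic_carrierI assms) (rule mod_mult_cong)
    show "x \<otimes>\<^bsub>?Z\<^esub> y \<otimes>\<^bsub>?Z\<^esub> z = x \<otimes>\<^bsub>?Z\<^esub> (y \<otimes>\<^bsub>?Z\<^esub> z)"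
      by (simp add: padic_simps mod_simps mult.assoc)
    show "x \<otimes>\<^bsub>?Z\<^esub> y = y \<otimes>\<^bsub>?Z\<^esub> x" by (simp add: padic_simps mult.commute)
    show "\<one>\<^bsub>?Z\<^esub> \<otimes>\<^bsub>?Z\<^esub> x = x" using x by (simp add: padic_simps mod_simps padic_digit_mod_self)
  next
    show "\<one>\<^bsub>?Z\<^esub> \<in> carrier ?Z" unfolding padic_simps by (rule padic_carrierI) (use assms in auto)
  qed
  show "(x \<oplus>\<^bsub>?Z\<^esub> y) \<otimes>\<^bsub>?Z\<^esub> z = x \<otimes>\<^bsub>?Z\<^esub> z \<oplus>\<^bsub>?Z\<^esub> y \<otimes>\<^bsub>?Z\<^esub> z" for x y z
    by (simp add: padic_simps mod_simps distrib_right)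
qed

text \<open>A nonzero \<open>c\<close> has a valuation \<open>v\<close>: the largest index at which its residue vanishes. Dividing the
  residue modulo \<open>p ^ (n + v)\<close> by \<open>p ^ v\<close> leaves a unit modulo \<open>p ^ n\<close>; the shift of the index by \<open>v\<close>
  makes up for the precision lost in the division.\<close>
lemma padic_shifted_quotient:
  assumes p: "prime p" and c: "c \<in> carrier (padic_integers p)"
    and v: "c v = 0" "c (Suc v) \<noteq> 0"
  obtains c' where "\<And>n. c (n + v) = int p ^ v * c' n" and "\<And>n. coprime (c' n) (int p ^ n)"
proof
  fix n
  have "c (n + v) mod int p ^ v = 0" using padic_digit_mod[OF c, of v "n + v"] v by simp
  then show eq: "c (n + v) = int p ^ v * (c (n + v) div int p ^ v)" by auto
  show "coprime (c (n + v) div int p ^ v) (int p ^ n)"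
  proof (cases n)
    case (Suc m)
    have "\<not> int p dvd c (n + v) div int p ^ v"
    proof
      assume "int p dvd c (n + v) div int p ^ v"
      then have "int p ^ v * int p dvd c (n + v)" by (subst eq) simp
      then have "c (n + v) mod int p ^ Suc v = 0" by (simp add: mult.commute mod_eq_0_iff_dvd)
      with padic_digit_mod[OF c, of "Suc v" "n + v"] v Suc show False by simp
    qed
    then have "coprime (int p) (c (n + v) div int p ^ v)"
      using p by (intro prime_imp_coprime) simp_all
    then show ?thesis by (simp add: coprime_commute)
  qed simp
qed

text \<open>Divisibility is decided by valuations. After both residues are divided by \<open>p ^ v\<close>, the quotient
  \<open>q\<close> is determined modulo \<open>p ^ n\<close> by a congruence whose left-hand coefficient is a unit; because it
  is determined, its values for varying \<open>n\<close> are compatible and define a \<open>p\<close>-adic integer.\<close>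
lemma padic_dvd_of_leading_digit:
  assumes p: "prime p"
    and c: "c \<in> carrier (padic_integers p)" "c v = 0" "c (Suc v) \<noteq> 0"
    and x: "x \<in> carrier (padic_integers p)" "x v = 0"
  shows "\<exists>q \<in> carrier (padic_integers p). x = q \<otimes>\<^bsub>padic_integers p\<^esub> c"
proof -
  have p0: "0 < p" using p by (rule prime_gt_0_nat)
  obtain c' where c': "\<And>n. c (n + v) = int p ^ v * c' n" "\<And>n. coprime (c' n) (int p ^ n)"
    using padic_shifted_quotient[OF p c] by blast
  have "int p ^ v dvd x (n + v)" for n
    using padic_digit_mod[OF x(1), of v "n + v"] x(2) by auto
  then obtain x' where x': "\<And>n. x (n + v) = int p ^ v * x' n"
    unfolding dvd_def by metis
  have "\<exists>q. [c' n * q = x' n] (mod int p ^ n)" for n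
  proof -
    obtain u where "[c' n * u = 1] (mod int p ^ n)" using cong_solve_coprime_int c'(2) by blast
    then have "[c' n * u * x' n = 1 * x' n] (mod int p ^ n)" by (rule cong_scalar_right)
    then show ?thesis by (intro exI[of _ "u * x' n"]) (simp add: mult.assoc)
  qed
  then obtain q where q: "\<And>n. [c' n * q n = x' n] (mod int p ^ n)" by metis
  have step: "[c' (Suc n) = c' n] (mod int p ^ n)" "[x' (Suc n) = x' n] (mod int p ^ n)" for n
  proof -
    have *: "[z (Suc n) = z n] (mod int p ^ n)"
      if y: "y \<in> carrier (padic_integers p)" and z: "\<And>n. y (n + v) = int p ^ v * z n" for y z
    proof -
      have "y (Suc n + v) mod int p ^ (n + v) = y (n + v) mod int p ^ (n + v)"
        using padic_digit_mod[OF y, of "n + v" "Suc n + v"] padic_digit_mod_self[OF y] by simp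
      then have "int p ^ v * z (Suc n) mod (int p ^ v * int p ^ n) =
        int p ^ v * z n mod (int p ^ v * int p ^ n)"
        unfolding z by (simp add: power_add mult.commute)
      then show ?thesis using p0 by (simp add: cong_def)
    qed
    show "[c' (Suc n) = c' n] (mod int p ^ n)" "[x' (Suc n) = x' n] (mod int p ^ n)"
      using *[OF c(1) c'(1)] *[OF x(1) x'] by auto
  qed
  have "[q (Suc n) = q n] (mod int p ^ n)" for n
  proof -
    \<comment> \<open>Both \<open>q (Suc n)\<close> and \<open>q n\<close> solve the congruence that determines \<open>q\<close> modulo \<open>p ^ n\<close>.\<close>
    have "[c' (Suc n) * q (Suc n) = x' (Suc n)] (mod int p ^ n)"
      using q[of "Suc n"] by (rule cong_dvd_modulus) simp
    moreover have "[c' (Suc n) * q (Suc n) = c' n * q (Suc n)] (mod int p ^ n)"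
      using step(1) by (rule cong_scalar_right)
    ultimately have "[c' n * q (Suc n) = c' n * q n] (mod int p ^ n)"
      using step(2)[of n] q[of n] by (simp add: cong_def)
    then show ?thesis using c'(2) cong_mult_lcancel by blast
  qed
  then have "(\<lambda>n. q n mod int p ^ n) \<in> carrier (padic_integers p)"
    by (intro padic_carrierI p0) (simp add: cong_def)
  moreover have "x = (\<lambda>n. q n mod int p ^ n) \<otimes>\<^bsub>padic_integers p\<^esub> c"
  proof
    fix n
    have "[int p ^ v * (c' n * q n) = int p ^ v * x' n] (mod int p ^ n)"
      using q by (rule cong_scalar_left)
    then have "(c (n + v) * q n) mod int p ^ n = x (n + v) mod int p ^ n"
      by (simp add: cong_def c' x' mult.assoc)
    then have "(c n * q n) mod int p ^ n = x n"
      using padic_digit_mod[OF x(1), of n "n + v"] padic_digit_mod[OF c(1), of n "n + v"]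
      by (metis le_add1 mod_mult_left_eq)
    then show "x n = ((\<lambda>n. q n mod int p ^ n) \<otimes>\<^bsub>padic_integers p\<^esub> c) n"
      by (simp add: padic_simps mod_simps mult.commute)
  qed
  ultimately show ?thesis by blast
qed

lemma padic_leading_digit:
  assumes p: "0 < p" and x: "x \<in> carrier (padic_integers p)" "x \<noteq> \<zero>\<^bsub>padic_integers p\<^esub>"
  shows "\<exists>v. x v = 0 \<and> x (Suc v) \<noteq> 0"
proof (rule ccontr)
  assume "\<not> ?thesis"
  then have step: "x v = 0 \<Longrightarrow> x (Suc v) = 0" for v by blast
  have "x n = 0" for n
  proof (induction n)
    case 0
    show ?case using padic_digit_mod_self[OF x(1), of 0] by simp
  qed (rule step)
  then show False using x(2) by (auto simp: padic_simps)
qed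

lemma padic_domain:
  assumes p: "prime p"
  shows "domain (padic_integers p)"
proof -
  let ?Z = "padic_integers p"
  have p0: "0 < p" using p by (rule prime_gt_0_nat)
  interpret cring ?Z using p0 by (rule padic_cring)
  show ?thesis
  proof (unfold_locales)
    show "\<one>\<^bsub>?Z\<^esub> \<noteq> \<zero>\<^bsub>?Z\<^esub>"
    proof
      assume "\<one>\<^bsub>?Z\<^esub> = \<zero>\<^bsub>?Z\<^esub>"
      then have "1 mod int p ^ 1 = 0" unfolding padic_simps by (rule fun_cong)
      then show False using prime_gt_1_nat[OF p] by simp
    qed
  next
    fix a b assume ab: "a \<otimes>\<^bsub>?Z\<^esub> b = \<zero>\<^bsub>?Z\<^esub>" and a: "a \<in> carrier ?Z" and b: "b \<in> carrier ?Z"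
    show "a = \<zero>\<^bsub>?Z\<^esub> \<or> b = \<zero>\<^bsub>?Z\<^esub>"
    proof (cases "a = \<zero>\<^bsub>?Z\<^esub>")
      case False
      then obtain v where "a v = 0" "a (Suc v) \<noteq> 0" using padic_leading_digit[OF p0 a] by blast
      then obtain a' where a': "\<And>n. a (n + v) = int p ^ v * a' n" "\<And>n. coprime (a' n) (int p ^ n)"
        using padic_shifted_quotient[OF p a] by blast
      have "b n = 0" for n
      proof -
        have "(a (n + v) * b (n + v)) mod int p ^ (n + v) = 0"
          using fun_cong[OF ab, of "n + v"] by (simp add: padic_simps)
        then have "int p ^ v * int p ^ n dvd int p ^ v * (a' n * b (n + v))"
          unfolding a' by (simp add: mod_eq_0_iff_dvd power_add mult_ac)
        then have "int p ^ n dvd a' n * b (n + v)" using p0 by simp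
        then have "int p ^ n dvd b (n + v)"
          using a'(2)[of n] by (simp add: coprime_commute coprime_dvd_mult_right_iff)
        then show ?thesis using padic_digit_mod[OF b, of n "n + v"] by simp
      qed
      then show ?thesis by (auto simp: padic_simps)
    qed simp
  qed
qed

text \<open>An element of least valuation in a nonzero ideal divides all the others.\<close>

lemma padic_ideal_principal:
  assumes p: "prime p" and I: "ideal I (padic_integers p)"
  shows "\<exists>a \<in> carrier (padic_integers p). I = PIdl\<^bsub>padic_integers p\<^esub> a"
proof -
  let ?Z = "padic_integers p"
  have p0: "0 < p" using p by (rule prime_gt_0_nat)
  interpret cring ?Z using p0 by (rule padic_cring)
  interpret I: ideal I ?Z by (rule I)
    show "\<exists>a \<in> carrier ?Z. I = PIdl\<^bsub>?Z\<^esub> a"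
    proof (cases "I = {\<zero>\<^bsub>?Z\<^esub>}")
      case True
      then show ?thesis by (intro bexI[of _ "\<zero>\<^bsub>?Z\<^esub>"]) (auto simp: cgenideal_def intro!: exI[of _ "\<zero>\<^bsub>?Z\<^esub>"])
    next
      case False
      then obtain x where x: "x \<in> I" "x \<noteq> \<zero>\<^bsub>?Z\<^esub>" using I.zero_closed by blast
      \<comment> \<open>\<open>P v\<close>: some element of \<open>I\<close> has valuation at most \<open>v\<close>.\<close>
      define P where "P v \<longleftrightarrow> (\<exists>c \<in> I. c (Suc v) \<noteq> 0)" for v
      define v where "v = (LEAST v. P v)"
      have carr: "y \<in> carrier ?Z" if "y \<in> I" for y using I.a_subset that by blast
      have "\<exists>v. P v" unfolding P_def using x(1) padic_leading_digit[OF p0 carr[OF x(1)] x(2)] by blast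
      then have "P v" unfolding v_def by (metis LeastI)
      then obtain c where c: "c \<in> I" "c (Suc v) \<noteq> 0" unfolding P_def by blast
      have zero: "y v = 0" if "y \<in> I" for y
      proof (cases v)
        case 0
        then show ?thesis using padic_digit_mod_self[OF carr[OF that], of 0] by simp
      next
        case (Suc w)
        then have "\<not> P w" unfolding v_def by (metis lessI not_less_Least)
        then show ?thesis using that Suc by (auto simp: P_def)
      qed
      have "I \<subseteq> PIdl\<^bsub>?Z\<^esub> c"
      proof
        fix y assume y: "y \<in> I"
        have "\<exists>q \<in> carrier ?Z. y = q \<otimes>\<^bsub>?Z\<^esub> c"
          using padic_dvd_of_leading_digit[OF p carr[OF c(1)] zero[OF c(1)] c(2) carr[OF y] zero[OF y]] .
        then show "y \<in> PIdl\<^bsub>?Z\<^esub> c" by (auto simp: cgenideal_def)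
      qed
      moreover have "PIdl\<^bsub>?Z\<^esub> c \<subseteq> I" by (rule cgenideal_minimal[OF I c(1)])
      ultimately show ?thesis using carr[OF c(1)] by (intro bexI[of _ c]) auto
    qed
qed


section \<open>Divisibility of the fraction field modulo the domain\<close>

context domain
begin

lemma equiv_frac_rel: "equiv (carrier R \<times> (carrier R - {\<zero>})) (frac_rel R)"
proof (rule equivI)
  show "refl_on (carrier R \<times> (carrier R - {\<zero>})) (frac_rel R)"
    by (auto simp: refl_on_def frac_rel_def)
  show "frac_rel R \<subseteq> (carrier R \<times> (carrier R - {\<zero>})) \<times> (carrier R \<times> (carrier R - {\<zero>}))"
    by (auto simp: frac_rel_def)
  show "sym (frac_rel R)" by (auto simp: sym_def frac_rel_def)
  show "trans (frac_rel R)"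
  proof (rule transI)
    fix u v w assume "(u, v) \<in> frac_rel R" "(v, w) \<in> frac_rel R"
    then obtain a b c d e f where uvw: "u = (a, b)" "v = (c, d)" "w = (e, f)"
      and carr: "a \<in> carrier R" "b \<in> carrier R" "c \<in> carrier R" "d \<in> carrier R" "e \<in> carrier R"
        "f \<in> carrier R" and nz: "b \<noteq> \<zero>" "d \<noteq> \<zero>" "f \<noteq> \<zero>"
      and eqs: "a \<otimes> d = c \<otimes> b" "c \<otimes> f = e \<otimes> d"
      by (auto simp: frac_rel_def)
    have "d \<otimes> (a \<otimes> f) = (a \<otimes> d) \<otimes> f" using carr by (simp add: m_ac)
    also have "\<dots> = (c \<otimes> f) \<otimes> b" using carr by (simp add: eqs(1) m_ac)
    also have "\<dots> = d \<otimes> (e \<otimes> b)" using carr by (simp add: eqs(2) m_ac)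
    finally have "a \<otimes> f = e \<otimes> b" using carr nz by (simp add: m_lcancel)
    then show "(u, w) \<in> frac_rel R" using carr nz by (simp add: frac_rel_def uvw)
  qed
qed

lemma mk_frac_eq_iff:
  assumes "a \<in> carrier R" "b \<in> carrier R - {\<zero>}" "c \<in> carrier R" "d \<in> carrier R - {\<zero>}"
  shows "mk_frac R a b = mk_frac R c d \<longleftrightarrow> a \<otimes> d = c \<otimes> b"
  unfolding mk_frac_def using eq_equiv_class_iff[OF equiv_frac_rel, of "(a, b)" "(c, d)"] assms
  by (simp add: frac_rel_def)

lemma fraction_field_carrier_iff:
  "S \<in> carrier (fraction_field R) \<longleftrightarrow>
    (\<exists>a \<in> carrier R. \<exists>b \<in> carrier R - {\<zero>}. S = mk_frac R a b)"
  by (auto simp: fraction_field_def mk_frac_def quotient_def)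

lemma mem_mk_frac:
  assumes "a \<in> carrier R" "b \<in> carrier R - {\<zero>}"
  shows "(c, d) \<in> mk_frac R a b \<longleftrightarrow> c \<in> carrier R \<and> d \<in> carrier R - {\<zero>} \<and> a \<otimes> d = c \<otimes> b"
  using assms by (auto simp: mk_frac_def frac_rel_def)

lemma mult_nonzero:
  assumes "b \<in> carrier R - {\<zero>}" "d \<in> carrier R - {\<zero>}"
  shows "b \<otimes> d \<in> carrier R - {\<zero>}"
  using assms integral by auto

lemma fraction_field_add:
  assumes "a \<in> carrier R" "b \<in> carrier R - {\<zero>}" "c \<in> carrier R" "d \<in> carrier R - {\<zero>}"
  shows "mk_frac R a b \<oplus>\<^bsub>fraction_field R\<^esub> mk_frac R c d =
    mk_frac R (a \<otimes> d \<oplus> c \<otimes> b) (b \<otimes> d)"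
proof -
  have eq: "mk_frac R (a' \<otimes> d' \<oplus> c' \<otimes> b') (b' \<otimes> d') = mk_frac R (a \<otimes> d \<oplus> c \<otimes> b) (b \<otimes> d)"
    if "(a', b') \<in> mk_frac R a b" "(c', d') \<in> mk_frac R c d" for a' b' c' d'
  proof -
    note carr = that[unfolded mem_mk_frac[OF assms(1,2)] mem_mk_frac[OF assms(3,4)]]
    then have cl: "a' \<in> carrier R" "b' \<in> carrier R" "c' \<in> carrier R" "d' \<in> carrier R" by auto
    have "(a' \<otimes> d' \<oplus> c' \<otimes> b') \<otimes> (b \<otimes> d) = (a' \<otimes> b) \<otimes> (d' \<otimes> d) \<oplus> (c' \<otimes> d) \<otimes> (b' \<otimes> b)"
      using assms cl by (simp add: l_distr r_distr m_ac)
    also have "\<dots> = (a \<otimes> b') \<otimes> (d' \<otimes> d) \<oplus> (c \<otimes> d') \<otimes> (b' \<otimes> b)"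
      using carr by (metis (no_types))
    also have "\<dots> = (a \<otimes> d \<oplus> c \<otimes> b) \<otimes> (b' \<otimes> d')"
      using assms cl by (simp add: l_distr r_distr m_ac)
    finally show ?thesis
      using assms carr mult_nonzero[of b d] mult_nonzero[of b' d'] by (subst mk_frac_eq_iff) auto
  qed
  have "(a, b) \<in> mk_frac R a b" "(c, d) \<in> mk_frac R c d" using assms by (auto simp: mem_mk_frac)
  then have "(\<Union>(a', b') \<in> mk_frac R a b. \<Union>(c', d') \<in> mk_frac R c d.
      mk_frac R (a' \<otimes> d' \<oplus> c' \<otimes> b') (b' \<otimes> d')) = mk_frac R (a \<otimes> d \<oplus> c \<otimes> b) (b \<otimes> d)"
    by (intro SUP_eq_const) (auto intro!: SUP_eq_const eq)
  then show ?thesis by (simp add: fraction_field_def)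
qed

lemma fraction_field_smult:
  assumes "r \<in> carrier R" "a \<in> carrier R" "b \<in> carrier R - {\<zero>}"
  shows "r \<odot>\<^bsub>fraction_field R\<^esub> mk_frac R a b = mk_frac R (r \<otimes> a) b"
proof -
  have eq: "mk_frac R (r \<otimes> a') b' = mk_frac R (r \<otimes> a) b" if "(a', b') \<in> mk_frac R a b" for a' b'
  proof -
    note carr = that[unfolded mem_mk_frac[OF assms(2,3)]]
    have "(r \<otimes> a') \<otimes> b = (r \<otimes> a) \<otimes> b'" using assms carr by (simp add: m_assoc)
    then show ?thesis using assms carr by (subst mk_frac_eq_iff) auto
  qed
  have "(a, b) \<in> mk_frac R a b" using assms by (auto simp: mem_mk_frac)
  then have "mk_frac R a b \<noteq> {}" by blast
  moreover have "(case u of (a', b') \<Rightarrow> mk_frac R (r \<otimes> a') b') = mk_frac R (r \<otimes> a) b"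
    if "u \<in> mk_frac R a b" for u
    using eq[of "fst u" "snd u"] that by (simp add: case_prod_beta)
  ultimately have "(\<Union>(a', b') \<in> mk_frac R a b. mk_frac R (r \<otimes> a') b') = mk_frac R (r \<otimes> a) b"
    by (rule SUP_eq_const)
  then show ?thesis by (simp add: fraction_field_def)
qed

lemma fraction_field_zero: "\<zero>\<^bsub>fraction_field R\<^esub> = mk_frac R \<zero> \<one>"
  by (simp add: fraction_field_def)

lemma abelian_group_fraction_field: "abelian_group (fraction_field R)"
proof (rule abelian_groupI)
  fix x y z
  assume "x \<in> carrier (fraction_field R)" "y \<in> carrier (fraction_field R)"
    "z \<in> carrier (fraction_field R)"
  then obtain a b c d e f
    where ab: "a \<in> carrier R" "b \<in> carrier R - {\<zero>}" "x = mk_frac R a b"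
      and cd: "c \<in> carrier R" "d \<in> carrier R - {\<zero>}" "y = mk_frac R c d"
      and ef: "e \<in> carrier R" "f \<in> carrier R - {\<zero>}" "z = mk_frac R e f"
    unfolding fraction_field_carrier_iff by metis
  note nz = mult_nonzero[OF ab(2) cd(2)] mult_nonzero[OF cd(2) ef(2)]
  have xy: "x \<oplus>\<^bsub>fraction_field R\<^esub> y = mk_frac R (a \<otimes> d \<oplus> c \<otimes> b) (b \<otimes> d)"
    unfolding ab cd by (rule fraction_field_add) fact+
  then show "x \<oplus>\<^bsub>fraction_field R\<^esub> y \<in> carrier (fraction_field R)"
    unfolding fraction_field_carrier_iff using ab cd nz by blast
  have yz: "y \<oplus>\<^bsub>fraction_field R\<^esub> z = mk_frac R (c \<otimes> f \<oplus> e \<otimes> d) (d \<otimes> f)"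
    unfolding cd ef by (rule fraction_field_add) fact+
  have "x \<oplus>\<^bsub>fraction_field R\<^esub> y \<oplus>\<^bsub>fraction_field R\<^esub> z =
    mk_frac R ((a \<otimes> d \<oplus> c \<otimes> b) \<otimes> f \<oplus> e \<otimes> (b \<otimes> d)) (b \<otimes> d \<otimes> f)"
    unfolding xy ef(3) using ab cd ef nz by (intro fraction_field_add) auto
  also have "\<dots> = mk_frac R (a \<otimes> (d \<otimes> f) \<oplus> (c \<otimes> f \<oplus> e \<otimes> d) \<otimes> b) (b \<otimes> (d \<otimes> f))"
    using ab cd ef by (intro arg_cong2[of _ _ _ _ "mk_frac R"]) (simp_all add: l_distr r_distr m_ac a_ac)
  also have "\<dots> = x \<oplus>\<^bsub>fraction_field R\<^esub> (y \<oplus>\<^bsub>fraction_field R\<^esub> z)"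
    unfolding yz ab(3) using ab cd ef nz by (intro fraction_field_add[symmetric]) auto
  finally show "x \<oplus>\<^bsub>fraction_field R\<^esub> y \<oplus>\<^bsub>fraction_field R\<^esub> z =
    x \<oplus>\<^bsub>fraction_field R\<^esub> (y \<oplus>\<^bsub>fraction_field R\<^esub> z)" .
  show "x \<oplus>\<^bsub>fraction_field R\<^esub> y = y \<oplus>\<^bsub>fraction_field R\<^esub> x"
    unfolding ab(3) cd(3) using ab cd by (simp add: fraction_field_add m_comm a_comm)
  show "\<zero>\<^bsub>fraction_field R\<^esub> \<oplus>\<^bsub>fraction_field R\<^esub> x = x"
    unfolding ab(3) fraction_field_zero using ab by (simp add: fraction_field_add)
  have "(\<ominus> a \<otimes> b \<oplus> a \<otimes> b) = \<zero>" using ab by (simp add: l_minus l_neg)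
  then have "mk_frac R (\<ominus> a) b \<oplus>\<^bsub>fraction_field R\<^esub> x = \<zero>\<^bsub>fraction_field R\<^esub>"
    unfolding ab(3) fraction_field_zero using ab mult_nonzero[OF ab(2) ab(2)]
    by (simp add: fraction_field_add mk_frac_eq_iff)
  moreover have "mk_frac R (\<ominus> a) b \<in> carrier (fraction_field R)"
    unfolding fraction_field_carrier_iff using ab by blast
  ultimately show "\<exists>y \<in> carrier (fraction_field R). y \<oplus>\<^bsub>fraction_field R\<^esub> x = \<zero>\<^bsub>fraction_field R\<^esub>"
    by blast
next
  show "\<zero>\<^bsub>fraction_field R\<^esub> \<in> carrier (fraction_field R)"
    unfolding fraction_field_zero fraction_field_carrier_iff by (metis DiffI one_closed one_not_zero singletonD zero_closed)
qed

lemma fraction_field_smult_closed: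
  assumes "r \<in> carrier R" "x \<in> carrier (fraction_field R)"
  shows "r \<odot>\<^bsub>fraction_field R\<^esub> x \<in> carrier (fraction_field R)"
proof -
  obtain a b where "a \<in> carrier R" "b \<in> carrier R - {\<zero>}" "x = mk_frac R a b"
    using assms(2) unfolding fraction_field_carrier_iff by metis
  then show ?thesis
    unfolding fraction_field_carrier_iff using assms(1)
    by (intro bexI[of _ "r \<otimes> a"] bexI[of _ b]) (simp_all add: fraction_field_smult)
qed

lemma fraction_field_smult_r_distr:
  assumes r: "r \<in> carrier R"
    and "x \<in> carrier (fraction_field R)" "y \<in> carrier (fraction_field R)"
  shows "r \<odot>\<^bsub>fraction_field R\<^esub> (x \<oplus>\<^bsub>fraction_field R\<^esub> y) =
    r \<odot>\<^bsub>fraction_field R\<^esub> x \<oplus>\<^bsub>fraction_field R\<^esub> r \<odot>\<^bsub>fraction_field R\<^esub> y"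
proof -
  obtain a b c d
    where ab: "a \<in> carrier R" "b \<in> carrier R - {\<zero>}" "x = mk_frac R a b"
      and cd: "c \<in> carrier R" "d \<in> carrier R - {\<zero>}" "y = mk_frac R c d"
    using assms unfolding fraction_field_carrier_iff by metis
  show ?thesis
    unfolding ab(3) cd(3) using r ab cd mult_nonzero[OF ab(2) cd(2)]
    by (simp add: fraction_field_add fraction_field_smult r_distr m_assoc)
qed

lemma fraction_field_divisible:
  assumes "c \<in> carrier R - {\<zero>}" "x \<in> carrier (fraction_field R)"
  shows "\<exists>y \<in> carrier (fraction_field R). c \<odot>\<^bsub>fraction_field R\<^esub> y = x"
proof -
  obtain a b where ab: "a \<in> carrier R" "b \<in> carrier R - {\<zero>}" "x = mk_frac R a b"
    using assms unfolding fraction_field_carrier_iff by metis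
  have cb: "c \<otimes> b \<in> carrier R - {\<zero>}" using assms(1) ab(2) by (rule mult_nonzero)
  have "c \<odot>\<^bsub>fraction_field R\<^esub> mk_frac R a (c \<otimes> b) = x"
    unfolding ab(3) using assms(1) ab cb by (simp add: fraction_field_smult mk_frac_eq_iff m_ac)
  moreover have "mk_frac R a (c \<otimes> b) \<in> carrier (fraction_field R)"
    unfolding fraction_field_carrier_iff using ab(1) cb by blast
  ultimately show ?thesis by blast
qed

lemma additive_subgroup_integral_fractions:
  "additive_subgroup ((\<lambda>a. mk_frac R a \<one>) ` carrier R) (fraction_field R)"
proof -
  interpret Q: abelian_group "fraction_field R" by (rule abelian_group_fraction_field)
  have add: "mk_frac R a \<one> \<oplus>\<^bsub>fraction_field R\<^esub> mk_frac R b \<one> = mk_frac R (a \<oplus> b) \<one>"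
    if "a \<in> carrier R" "b \<in> carrier R" for a b
    using that by (simp add: fraction_field_add)
  have carr: "mk_frac R a \<one> \<in> carrier (fraction_field R)" if "a \<in> carrier R" for a
    unfolding fraction_field_carrier_iff using that by (intro bexI[of _ a] bexI[of _ \<one>]) auto
  show ?thesis
  proof (rule additive_subgroupI, rule group.subgroupI)
    show "group (add_monoid (fraction_field R))" by (rule Q.a_group)
    show "(\<lambda>a. mk_frac R a \<one>) ` carrier R \<subseteq> carrier (add_monoid (fraction_field R))"
      using carr by auto
    show "(\<lambda>a. mk_frac R a \<one>) ` carrier R \<noteq> {}" by auto
  next
    fix x assume "x \<in> (\<lambda>a. mk_frac R a \<one>) ` carrier R"
    then obtain a where a: "a \<in> carrier R" "x = mk_frac R a \<one>" by blast
    have "mk_frac R (\<ominus> a) \<one> \<oplus>\<^bsub>fraction_field R\<^esub> x = \<zero>\<^bsub>fraction_field R\<^esub>"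
      using a add[of "\<ominus> a" a] by (simp add: l_neg fraction_field_zero)
    then have "\<ominus>\<^bsub>fraction_field R\<^esub> x = mk_frac R (\<ominus> a) \<one>"
      using a carr by (intro Q.minus_equality) auto
    then show "inv\<^bsub>add_monoid (fraction_field R)\<^esub> x \<in> (\<lambda>a. mk_frac R a \<one>) ` carrier R"
      using a(1) by (simp add: a_inv_def)
  next
    fix x y assume "x \<in> (\<lambda>a. mk_frac R a \<one>) ` carrier R" "y \<in> (\<lambda>a. mk_frac R a \<one>) ` carrier R"
    then show "x \<otimes>\<^bsub>add_monoid (fraction_field R)\<^esub> y \<in> (\<lambda>a. mk_frac R a \<one>) ` carrier R"
      using add by auto
  qed
qed

text \<open>Divisibility passes from the fraction field to its quotient by the domain. The scalar multiple of
  a coset is a union over representatives, so it has to be seen that each representative contributes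
  the same coset.\<close>

lemma fraction_field_mod_integral_divisible:
  assumes c: "c \<in> carrier R - {\<zero>}"
    and S: "S \<in> carrier (quotient_module (fraction_field R) ((\<lambda>a. mk_frac R a \<one>) ` carrier R))"
  shows "\<exists>T \<in> carrier (quotient_module (fraction_field R) ((\<lambda>a. mk_frac R a \<one>) ` carrier R)).
    c \<odot>\<^bsub>quotient_module (fraction_field R) ((\<lambda>a. mk_frac R a \<one>) ` carrier R)\<^esub> T = S"
proof -
  let ?Q = "fraction_field R" and ?N = "(\<lambda>a. mk_frac R a \<one>) ` carrier R"
  interpret Q: abelian_group ?Q by (rule abelian_group_fraction_field)
  interpret N: additive_subgroup ?N ?Q by (rule additive_subgroup_integral_fractions)
  obtain x where x: "x \<in> carrier ?Q" "S = ?N +>\<^bsub>?Q\<^esub> x"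
    using S by (auto simp: quotient_module_def A_RCOSETS_def')
  obtain y where y: "y \<in> carrier ?Q" "c \<odot>\<^bsub>?Q\<^esub> y = x" using fraction_field_divisible[OF c x(1)] by blast
  have "?N +>\<^bsub>?Q\<^esub> (c \<odot>\<^bsub>?Q\<^esub> z) = S" if z: "z \<in> ?N +>\<^bsub>?Q\<^esub> y" for z
  proof -
    obtain n where n: "n \<in> ?N" "z = n \<oplus>\<^bsub>?Q\<^esub> y" using z by (auto simp: a_r_coset_def')
    have nQ: "n \<in> carrier ?Q" using n(1) N.a_subset by blast
    have cn: "c \<odot>\<^bsub>?Q\<^esub> n \<in> ?N" using n(1) c by (auto simp: fraction_field_smult)
    have "?N +>\<^bsub>?Q\<^esub> (c \<odot>\<^bsub>?Q\<^esub> z) = ?N +>\<^bsub>?Q\<^esub> (c \<odot>\<^bsub>?Q\<^esub> n) +>\<^bsub>?Q\<^esub> x"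
      unfolding n(2) using c nQ y x cn N.a_subset
      by (subst Q.a_coset_add_assoc) (auto simp: fraction_field_smult_r_distr fraction_field_smult_closed)
    also have "?N +>\<^bsub>?Q\<^esub> (c \<odot>\<^bsub>?Q\<^esub> n) = ?N"
      using cn N.a_subset N.a_subgroup by (intro Q.a_coset_join2) auto
    finally show ?thesis using x(2) by simp
  qed
  moreover have "y \<in> ?N +>\<^bsub>?Q\<^esub> y"
    using N.zero_closed Q.l_zero[OF y(1)] unfolding a_r_coset_def' by force
  ultimately have "c \<odot>\<^bsub>quotient_module ?Q ?N\<^esub> (?N +>\<^bsub>?Q\<^esub> y) = S"
    unfolding quotient_module_def by simp blast
  moreover have "?N +>\<^bsub>?Q\<^esub> y \<in> carrier (quotient_module ?Q ?N)"
    using y(1) by (auto simp: quotient_module_def A_RCOSETS_def')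
  ultimately show ?thesis by blast
qed

end

lemma Qp_mod_Zp_divisible:
  assumes "domain (padic_integers p)"
    and "c \<in> carrier (padic_integers p) - {\<zero>\<^bsub>padic_integers p\<^esub>}" "x \<in> carrier (Qp_mod_Zp p)"
  shows "\<exists>y \<in> carrier (Qp_mod_Zp p). c \<odot>\<^bsub>Qp_mod_Zp p\<^esub> y = x"
  using assms(2,3) unfolding Qp_mod_Zp_def padic_numbers_def
  by (rule domain.fraction_field_mod_integral_divisible[OF assms(1)])


section \<open>Divisible modules are injective\<close>

text \<open>The graph of a linear map from a submodule of \<open>V\<close> to \<open>T\<close>. For a graph closed under the module
  operations, single-valuedness at \<open>\<zero>\<close> is the same as single-valuedness. Graphs, unlike pairs
  of a submodule and a map on it, are ordered by inclusion, and the union of a chain is again one.\<close>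
definition linear_graph ::
  "('k, 'r) ring_scheme \<Rightarrow> ('k, 'v, 'm) module_scheme \<Rightarrow> ('k, 't, 'n) module_scheme \<Rightarrow>
   ('v \<times> 't) set \<Rightarrow> bool"
  where "linear_graph K V T G \<longleftrightarrow>
    G \<subseteq> carrier V \<times> carrier T \<and> (\<zero>\<^bsub>V\<^esub>, \<zero>\<^bsub>T\<^esub>) \<in> G \<and>
    (\<forall>x s y t. (x, s) \<in> G \<longrightarrow> (y, t) \<in> G \<longrightarrow> (x \<oplus>\<^bsub>V\<^esub> y, s \<oplus>\<^bsub>T\<^esub> t) \<in> G) \<and>
    (\<forall>c \<in> carrier K. \<forall>x t. (x, t) \<in> G \<longrightarrow> (c \<odot>\<^bsub>V\<^esub> x, c \<odot>\<^bsub>T\<^esub> t) \<in> G) \<and>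
    (\<forall>t. (\<zero>\<^bsub>V\<^esub>, t) \<in> G \<longrightarrow> t = \<zero>\<^bsub>T\<^esub>)"

lemma linear_graphD:
  assumes "linear_graph K V T G"
  shows "(x, t) \<in> G \<Longrightarrow> x \<in> carrier V" "(x, t) \<in> G \<Longrightarrow> t \<in> carrier T"
    and "(\<zero>\<^bsub>V\<^esub>, \<zero>\<^bsub>T\<^esub>) \<in> G"
    and "\<lbrakk>(x, s) \<in> G; (y, t) \<in> G\<rbrakk> \<Longrightarrow> (x \<oplus>\<^bsub>V\<^esub> y, s \<oplus>\<^bsub>T\<^esub> t) \<in> G"
    and "\<lbrakk>c \<in> carrier K; (x, t) \<in> G\<rbrakk> \<Longrightarrow> (c \<odot>\<^bsub>V\<^esub> x, c \<odot>\<^bsub>T\<^esub> t) \<in> G"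
    and "(\<zero>\<^bsub>V\<^esub>, t) \<in> G \<Longrightarrow> t = \<zero>\<^bsub>T\<^esub>"
  using assms unfolding linear_graph_def by blast+

lemma linear_graph_Union_chain:
  assumes "\<C> \<noteq> {}" and chain: "subset.chain {G. linear_graph K V T G} \<C>"
  shows "linear_graph K V T (\<Union>\<C>)"
proof -
  have lg: "linear_graph K V T G" if "G \<in> \<C>" for G
    using chain that by (auto simp: subset_chain_def)
  have common: "\<exists>G \<in> \<C>. u \<in> G \<and> v \<in> G" if "u \<in> \<Union>\<C>" "v \<in> \<Union>\<C>" for u v
    using chain that unfolding subset_chain_def by blast
  show ?thesis
    unfolding linear_graph_def[of K V T "\<Union>\<C>"]
  proof (intro conjI allI ballI impI)
    show "\<Union>\<C> \<subseteq> carrier V \<times> carrier T" using lg by (fastforce dest: linear_graphD)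
    show "(\<zero>\<^bsub>V\<^esub>, \<zero>\<^bsub>T\<^esub>) \<in> \<Union>\<C>" using \<open>\<C> \<noteq> {}\<close> lg by (auto dest: linear_graphD(3))
  next
    fix x s y t assume "(x, s) \<in> \<Union>\<C>" "(y, t) \<in> \<Union>\<C>"
    then obtain G where "G \<in> \<C>" "(x, s) \<in> G" "(y, t) \<in> G" using common by blast
    then show "(x \<oplus>\<^bsub>V\<^esub> y, s \<oplus>\<^bsub>T\<^esub> t) \<in> \<Union>\<C>" using lg by (blast intro: linear_graphD(4))
  next
    fix c x t assume "c \<in> carrier K" "(x, t) \<in> \<Union>\<C>"
    then show "(c \<odot>\<^bsub>V\<^esub> x, c \<odot>\<^bsub>T\<^esub> t) \<in> \<Union>\<C>" using lg by (blast intro: linear_graphD(5))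
  next
    fix t assume "(\<zero>\<^bsub>V\<^esub>, t) \<in> \<Union>\<C>"
    then show "t = \<zero>\<^bsub>T\<^esub>" using lg by (blast dest: linear_graphD(6))
  qed
qed

lemma linear_graph_single_valued:
  assumes "module K V" and "module K T" and G: "linear_graph K V T G"
    and st: "(x, s) \<in> G" "(x, t) \<in> G"
  shows "s = t"
proof -
  interpret V: module K V by fact
  interpret T: module K T by fact
  have carr: "x \<in> carrier V" "s \<in> carrier T" "t \<in> carrier T"
    using st linear_graphD(1,2)[OF G] by blast+
  have "(x \<oplus>\<^bsub>V\<^esub> \<ominus>\<^bsub>K\<^esub> \<one>\<^bsub>K\<^esub> \<odot>\<^bsub>V\<^esub> x, s \<oplus>\<^bsub>T\<^esub> \<ominus>\<^bsub>K\<^esub> \<one>\<^bsub>K\<^esub> \<odot>\<^bsub>T\<^esub> t) \<in> G"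
    using st by (intro linear_graphD(4,5)[OF G]) auto
  then have "(\<zero>\<^bsub>V\<^esub>, s \<ominus>\<^bsub>T\<^esub> t) \<in> G"
    using carr by (simp add: V.smult_l_minus T.smult_l_minus V.M.r_neg T.M.minus_eq)
  then have "s \<oplus>\<^bsub>T\<^esub> \<ominus>\<^bsub>T\<^esub> t = \<zero>\<^bsub>T\<^esub>"
    unfolding T.M.minus_eq[symmetric] by (rule linear_graphD(6)[OF G])
  then show ?thesis using carr by (metis T.M.minus_equality T.M.minus_minus T.M.a_inv_closed)
qed

lemma linear_graph_denominators_ideal:
  assumes "module K V" and "module K T" and G: "linear_graph K V T G" and y: "y \<in> carrier V"
  shows "ideal {c \<in> carrier K. \<exists>t. (c \<odot>\<^bsub>V\<^esub> y, t) \<in> G} K"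
proof -
  interpret V: module K V by fact
  interpret T: module K T by fact
  have mult: "\<exists>t. ((c \<otimes>\<^bsub>K\<^esub> b) \<odot>\<^bsub>V\<^esub> y, t) \<in> G"
    if "c \<in> carrier K" "b \<in> carrier K" "(b \<odot>\<^bsub>V\<^esub> y, t) \<in> G" for b c t
    using linear_graphD(5)[OF G that(1,3)] that y by (auto simp: V.smult_assoc1)
  show ?thesis
  proof (rule idealI[OF V.R.ring_axioms], rule group.subgroupI)
    show "group (add_monoid K)" by (rule V.R.a_group)
    show "{c \<in> carrier K. \<exists>t. (c \<odot>\<^bsub>V\<^esub> y, t) \<in> G} \<subseteq> carrier (add_monoid K)" by auto
    show "{c \<in> carrier K. \<exists>t. (c \<odot>\<^bsub>V\<^esub> y, t) \<in> G} \<noteq> {}"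
      using linear_graphD(3)[OF G] y V.smult_l_null by fastforce
  next
    fix b assume b: "b \<in> {c \<in> carrier K. \<exists>t. (c \<odot>\<^bsub>V\<^esub> y, t) \<in> G}"
    then obtain t where t: "b \<in> carrier K" "(b \<odot>\<^bsub>V\<^esub> y, t) \<in> G" by blast
    have "\<ominus>\<^bsub>K\<^esub> \<one>\<^bsub>K\<^esub> \<otimes>\<^bsub>K\<^esub> b = \<ominus>\<^bsub>K\<^esub> b" using t by (simp add: V.R.l_minus)
    then show "inv\<^bsub>add_monoid K\<^esub> b \<in> {c \<in> carrier K. \<exists>t. (c \<odot>\<^bsub>V\<^esub> y, t) \<in> G}"
      using mult[OF _ t, of "\<ominus>\<^bsub>K\<^esub> \<one>\<^bsub>K\<^esub>"] t by (simp add: a_inv_def[symmetric])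
    fix c assume c: "c \<in> {c \<in> carrier K. \<exists>t. (c \<odot>\<^bsub>V\<^esub> y, t) \<in> G}"
    then obtain s where s: "c \<in> carrier K" "(c \<odot>\<^bsub>V\<^esub> y, s) \<in> G" by blast
    show "b \<otimes>\<^bsub>add_monoid K\<^esub> c \<in> {c \<in> carrier K. \<exists>t. (c \<odot>\<^bsub>V\<^esub> y, t) \<in> G}"
      using linear_graphD(4)[OF G t(2) s(2)] t s y by (auto simp: V.smult_l_distr)
  next
    fix b c assume "b \<in> {c \<in> carrier K. \<exists>t. (c \<odot>\<^bsub>V\<^esub> y, t) \<in> G}" and c: "c \<in> carrier K"
    then obtain t where t: "b \<in> carrier K" "(b \<odot>\<^bsub>V\<^esub> y, t) \<in> G" by blast
    show "c \<otimes>\<^bsub>K\<^esub> b \<in> {c \<in> carrier K. \<exists>t. (c \<odot>\<^bsub>V\<^esub> y, t) \<in> G}"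
      using mult[OF c t] c t by simp
    then show "b \<otimes>\<^bsub>K\<^esub> c \<in> {c \<in> carrier K. \<exists>t. (c \<odot>\<^bsub>V\<^esub> y, t) \<in> G}"
      using V.R.m_comm[OF c t(1)] by simp
  qed
qed

text \<open>The step of Baer's criterion. The scalars \<open>c\<close> for which \<open>c y\<close> is in the domain of \<open>G\<close> form an
  ideal, generated by some \<open>a\<close>. If \<open>G\<close> sends \<open>a y\<close> to \<open>t\<^sub>0\<close>, divisibility provides an \<open>s\<close> with
  \<open>a s = t\<^sub>0\<close>, and \<open>y\<close> may be sent to \<open>s\<close>: every relation between \<open>y\<close> and the domain of \<open>G\<close> is a
  multiple of the one that \<open>s\<close> was chosen to respect.\<close>
lemma linear_graph_extend_by_element:
  assumes "module K V" and "module K T"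
    and principal: "\<And>I. ideal I K \<Longrightarrow> \<exists>a \<in> carrier K. I = PIdl\<^bsub>K\<^esub> a"
    and divisible: "\<And>c t. \<lbrakk>c \<in> carrier K - {\<zero>\<^bsub>K\<^esub>}; t \<in> carrier T\<rbrakk> \<Longrightarrow> \<exists>s \<in> carrier T. c \<odot>\<^bsub>T\<^esub> s = t"
    and G: "linear_graph K V T G" and y: "y \<in> carrier V"
  obtains G' s where "linear_graph K V T G'" "G \<subseteq> G'" "(y, s) \<in> G'"
proof -
  interpret V: module K V by fact
  interpret T: module K T by fact
  let ?I = "{c \<in> carrier K. \<exists>t. (c \<odot>\<^bsub>V\<^esub> y, t) \<in> G}"
  note Gcarr = linear_graphD(1,2)[OF G]
  obtain a where a: "a \<in> carrier K" "?I = PIdl\<^bsub>K\<^esub> a"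
    using principal[OF linear_graph_denominators_ideal[OF assms(1,2) G y]] by blast
  have "a \<in> ?I" unfolding a(2) using a(1) by (rule V.R.cgenideal_self)
  then obtain t0 where t0: "(a \<odot>\<^bsub>V\<^esub> y, t0) \<in> G" by blast
  have "\<exists>s \<in> carrier T. a \<odot>\<^bsub>T\<^esub> s = t0"
  proof (cases "a = \<zero>\<^bsub>K\<^esub>")
    \<comment> \<open>The ideal is zero: no multiple of \<open>y\<close> but \<open>\<zero>\<close> comes from the domain, and any \<open>s\<close> will do.\<close>
    case True
    then have "t0 = \<zero>\<^bsub>T\<^esub>" using t0 y linear_graphD(6)[OF G] by simp
    then show ?thesis using True by (intro bexI[of _ "\<zero>\<^bsub>T\<^esub>"]) auto
  next
    case False
    then show ?thesis using a(1) Gcarr(2)[OF t0] by (intro divisible) auto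
  qed
  then obtain s where s: "s \<in> carrier T" "a \<odot>\<^bsub>T\<^esub> s = t0" by blast
  define G' where "G' = {(x \<oplus>\<^bsub>V\<^esub> c \<odot>\<^bsub>V\<^esub> y, t \<oplus>\<^bsub>T\<^esub> c \<odot>\<^bsub>T\<^esub> s) | x t c. (x, t) \<in> G \<and> c \<in> carrier K}"
  have G'I: "(x', t') \<in> G'"
    if "(x, t) \<in> G" "c \<in> carrier K" "x' = x \<oplus>\<^bsub>V\<^esub> c \<odot>\<^bsub>V\<^esub> y" "t' = t \<oplus>\<^bsub>T\<^esub> c \<odot>\<^bsub>T\<^esub> s" for x t c x' t'
    unfolding G'_def using that by blast
  have G'E: "\<exists>x t c. (x, t) \<in> G \<and> c \<in> carrier K \<and> x' = x \<oplus>\<^bsub>V\<^esub> c \<odot>\<^bsub>V\<^esub> y \<and> t' = t \<oplus>\<^bsub>T\<^esub> c \<odot>\<^bsub>T\<^esub> s"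
    if "(x', t') \<in> G'" for x' t'
    using that unfolding G'_def by blast
  have sub: "G \<subseteq> G'"
    using Gcarr s y by (auto intro!: G'I[of _ _ "\<zero>\<^bsub>K\<^esub>"])
  have "(y, s) \<in> G'"
    using s y by (intro G'I[OF linear_graphD(3)[OF G], of "\<one>\<^bsub>K\<^esub>"]) auto
  moreover have "linear_graph K V T G'"
    unfolding linear_graph_def[of K V T G']
  proof (intro conjI allI ballI impI)
    show "G' \<subseteq> carrier V \<times> carrier T"
      using Gcarr y s unfolding G'_def by auto
    show "(\<zero>\<^bsub>V\<^esub>, \<zero>\<^bsub>T\<^esub>) \<in> G'" using sub linear_graphD(3)[OF G] by blast
  next
    fix x1 t1 x2 t2 assume "(x1, t1) \<in> G'" "(x2, t2) \<in> G'"
    then obtain u1 r1 c1 u2 r2 c2 where 1: "(u1, r1) \<in> G" "c1 \<in> carrier K"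
        "x1 = u1 \<oplus>\<^bsub>V\<^esub> c1 \<odot>\<^bsub>V\<^esub> y" "t1 = r1 \<oplus>\<^bsub>T\<^esub> c1 \<odot>\<^bsub>T\<^esub> s"
      and 2: "(u2, r2) \<in> G" "c2 \<in> carrier K"
        "x2 = u2 \<oplus>\<^bsub>V\<^esub> c2 \<odot>\<^bsub>V\<^esub> y" "t2 = r2 \<oplus>\<^bsub>T\<^esub> c2 \<odot>\<^bsub>T\<^esub> s"
      using G'E by metis
    show "(x1 \<oplus>\<^bsub>V\<^esub> x2, t1 \<oplus>\<^bsub>T\<^esub> t2) \<in> G'"
      using 1 2 Gcarr[OF 1(1)] Gcarr[OF 2(1)] y s
      by (intro G'I[OF linear_graphD(4)[OF G 1(1) 2(1)], of "c1 \<oplus>\<^bsub>K\<^esub> c2"])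
        (simp_all add: V.smult_l_distr T.smult_l_distr V.M.a_ac T.M.a_ac)
  next
    fix c x1 t1 assume c: "c \<in> carrier K" and "(x1, t1) \<in> G'"
    then obtain u1 r1 c1 where 1: "(u1, r1) \<in> G" "c1 \<in> carrier K"
        "x1 = u1 \<oplus>\<^bsub>V\<^esub> c1 \<odot>\<^bsub>V\<^esub> y" "t1 = r1 \<oplus>\<^bsub>T\<^esub> c1 \<odot>\<^bsub>T\<^esub> s"
      using G'E by metis
    show "(c \<odot>\<^bsub>V\<^esub> x1, c \<odot>\<^bsub>T\<^esub> t1) \<in> G'"
      using c 1 Gcarr[OF 1(1)] y s
      by (intro G'I[OF linear_graphD(5)[OF G c 1(1)], of "c \<otimes>\<^bsub>K\<^esub> c1"])
        (simp_all add: V.smult_r_distr T.smult_r_distr V.smult_assoc1 T.smult_assoc1)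
  next
    fix t' assume "(\<zero>\<^bsub>V\<^esub>, t') \<in> G'"
    then obtain x t c where x: "(x, t) \<in> G" and c: "c \<in> carrier K"
      and eqs: "\<zero>\<^bsub>V\<^esub> = x \<oplus>\<^bsub>V\<^esub> c \<odot>\<^bsub>V\<^esub> y" "t' = t \<oplus>\<^bsub>T\<^esub> c \<odot>\<^bsub>T\<^esub> s"
      using G'E by metis
    \<comment> \<open>Here \<open>c y = - x\<close> lies in the domain of \<open>G\<close>, so \<open>c\<close> is a multiple of \<open>a\<close>.\<close>
    have "c \<odot>\<^bsub>V\<^esub> y = \<ominus>\<^bsub>V\<^esub> x"
      using eqs(1) Gcarr[OF x] c y by (metis V.M.minus_equality V.M.minus_minus V.smult_closed)
    also have "\<dots> = \<ominus>\<^bsub>K\<^esub> \<one>\<^bsub>K\<^esub> \<odot>\<^bsub>V\<^esub> x" using Gcarr[OF x] by (simp add: V.smult_l_minus)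
    finally have "(c \<odot>\<^bsub>V\<^esub> y, \<ominus>\<^bsub>K\<^esub> \<one>\<^bsub>K\<^esub> \<odot>\<^bsub>T\<^esub> t) \<in> G"
      using linear_graphD(5)[OF G _ x, of "\<ominus>\<^bsub>K\<^esub> \<one>\<^bsub>K\<^esub>"] by simp
    then have "c \<in> PIdl\<^bsub>K\<^esub> a" using c a(2) by blast
    then obtain e where e: "e \<in> carrier K" "c = e \<otimes>\<^bsub>K\<^esub> a" by (auto simp: cgenideal_def)
    have "(x \<oplus>\<^bsub>V\<^esub> e \<odot>\<^bsub>V\<^esub> (a \<odot>\<^bsub>V\<^esub> y), t \<oplus>\<^bsub>T\<^esub> e \<odot>\<^bsub>T\<^esub> t0) \<in> G"
      using e x t0 by (intro linear_graphD(4,5)[OF G])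
    moreover have "e \<odot>\<^bsub>V\<^esub> (a \<odot>\<^bsub>V\<^esub> y) = c \<odot>\<^bsub>V\<^esub> y" "e \<odot>\<^bsub>T\<^esub> t0 = c \<odot>\<^bsub>T\<^esub> s"
      using e a(1) y s by (simp_all add: V.smult_assoc1 T.smult_assoc1)
    ultimately have "(\<zero>\<^bsub>V\<^esub>, t') \<in> G" using eqs by simp
    then show "t' = \<zero>\<^bsub>T\<^esub>" by (rule linear_graphD(6)[OF G])
  qed
  ultimately show ?thesis using sub that by blast
qed

text \<open>Divisible modules are injective over a ring whose ideals are principal: a maximal graph above \<open>G\<close>
  exists by Zorn's lemma, and its domain is all of \<open>V\<close> because otherwise it could be extended by one
  more element.\<close>
lemma linear_graph_extends_to_hom:
  assumes V: "module K V" and T: "module K T"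
    and principal: "\<And>I. ideal I K \<Longrightarrow> \<exists>a \<in> carrier K. I = PIdl\<^bsub>K\<^esub> a"
    and divisible: "\<And>c t. \<lbrakk>c \<in> carrier K - {\<zero>\<^bsub>K\<^esub>}; t \<in> carrier T\<rbrakk> \<Longrightarrow> \<exists>s \<in> carrier T. c \<odot>\<^bsub>T\<^esub> s = t"
    and G: "linear_graph K V T G"
  shows "\<exists>\<phi> \<in> module_hom K V T. \<forall>(x, t) \<in> G. \<phi> x = t"
proof -
  let ?A = "{H. linear_graph K V T H \<and> G \<subseteq> H}"
  have "\<exists>H \<in> ?A. \<forall>X \<in> ?A. H \<subseteq> X \<longrightarrow> X = H"
  proof (rule subset_Zorn_nonempty)
    show "?A \<noteq> {}" using G by blast
    fix \<C> assume C: "\<C> \<noteq> {}" "subset.chain ?A \<C>"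
    then have "subset.chain {H. linear_graph K V T H} \<C>" unfolding subset_chain_def by blast
    then have "linear_graph K V T (\<Union>\<C>)" using C(1) by (intro linear_graph_Union_chain)
    moreover have "G \<subseteq> \<Union>\<C>" using C unfolding subset_chain_def by blast
    ultimately show "\<Union>\<C> \<in> ?A" by blast
  qed
  then obtain H where "H \<in> ?A" and maximal: "\<forall>X \<in> ?A. H \<subseteq> X \<longrightarrow> X = H" by (rule bexE)
  then have H: "linear_graph K V T H" "G \<subseteq> H" by simp_all
  have max: "X = H" if "linear_graph K V T X" "H \<subseteq> X" for X
    using maximal that H(2) by simp
  have "\<exists>t. (y, t) \<in> H" if y: "y \<in> carrier V" for y
  proof -
    obtain X s where X: "linear_graph K V T X" "H \<subseteq> X" "(y, s) \<in> X"
      using linear_graph_extend_by_element[OF V T principal divisible H(1) y] .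
    then show ?thesis using max[OF X(1,2)] by blast
  qed
  then obtain \<phi> where \<phi>: "\<And>y. y \<in> carrier V \<Longrightarrow> (y, \<phi> y) \<in> H" by metis
  note sv = linear_graph_single_valued[OF V T H(1)]
  have unique: "\<phi> x = t" if "(x, t) \<in> H" for x t
    using sv[OF \<phi> that] linear_graphD(1)[OF H(1) that] by blast
  have "\<phi> \<in> module_hom K V T"
    unfolding module_hom_def hom_def
    using linear_graphD(2)[OF H(1) \<phi>] linear_graphD(4,5)[OF H(1)] \<phi>
    by (auto intro!: unique)
  then show ?thesis using unique H(2) by blast
qed


section \<open>Decomposition into homogeneous parts\<close>

definition homogeneous_parts :: "('b, 'm) ring_scheme \<Rightarrow> (int \<Rightarrow> 'b set) \<Rightarrow> 'b \<Rightarrow> int \<Rightarrow> 'b"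
  where "homogeneous_parts M B x =
    (THE c. (\<forall>k. c k \<in> B k) \<and> finite {k. c k \<noteq> \<zero>\<^bsub>M\<^esub>} \<and>
       x = (\<Oplus>\<^bsub>M\<^esub>k \<in> {k. c k \<noteq> \<zero>\<^bsub>M\<^esub>}. c k))"

context
  fixes M :: "('b, 'm) ring_scheme" (structure) and B :: "int \<Rightarrow> 'b set"
  assumes M: "abelian_group M" and grading: "is_grading M B"
begin

interpretation abelian_group M by (rule M)

lemma grading_component: "additive_subgroup (B k) M"
  using grading by (simp add: is_grading_def)

lemma grading_component_carrier: "x \<in> B k \<Longrightarrow> x \<in> carrier M"
  using additive_subgroup.a_subset[OF grading_component] by blast

lemma homogeneous_parts:
  assumes "x \<in> carrier M"
  shows "homogeneous_parts M B x k \<in> B k" "finite {k. homogeneous_parts M B x k \<noteq> \<zero>}"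
    "x = (\<Oplus>k \<in> {k. homogeneous_parts M B x k \<noteq> \<zero>}. homogeneous_parts M B x k)"
proof -
  have "\<exists>!c. (\<forall>k. c k \<in> B k) \<and> finite {k. c k \<noteq> \<zero>} \<and> x = (\<Oplus>k \<in> {k. c k \<noteq> \<zero>}. c k)"
    using grading assms by (simp add: is_grading_def)
  from theI'[OF this] show "homogeneous_parts M B x k \<in> B k"
    "finite {k. homogeneous_parts M B x k \<noteq> \<zero>}"
    "x = (\<Oplus>k \<in> {k. homogeneous_parts M B x k \<noteq> \<zero>}. homogeneous_parts M B x k)"
    by (simp_all add: homogeneous_parts_def)
qed

lemma finsum_support:
  assumes "\<And>k. c k \<in> carrier M" "finite F" "{k. c k \<noteq> \<zero>} \<subseteq> F"
  shows "(\<Oplus>k \<in> F. c k) = (\<Oplus>k \<in> {k. c k \<noteq> \<zero>}. c k)"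
  using assms by (intro add.finprod_mono_neutral_cong_right) auto

text \<open>The summation may range over any finite set containing the support, which is what makes sums of two
  decompositions with different supports tractable.\<close>
lemma homogeneous_parts_eqI:
  assumes "\<And>k. c k \<in> B k" "finite F" "{k. c k \<noteq> \<zero>} \<subseteq> F" "x = (\<Oplus>k \<in> F. c k)"
  shows "homogeneous_parts M B x = c"
proof -
  have c: "c k \<in> carrier M" for k using assms(1) by (rule grading_component_carrier)
  have "x \<in> carrier M" unfolding assms(4) using c by (intro finsum_closed) auto
  then have "\<exists>!c. (\<forall>k. c k \<in> B k) \<and> finite {k. c k \<noteq> \<zero>} \<and> x = (\<Oplus>k \<in> {k. c k \<noteq> \<zero>}. c k)"
    using grading by (simp add: is_grading_def)
  moreover have "x = (\<Oplus>k \<in> {k. c k \<noteq> \<zero>}. c k)"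
    using finsum_support[OF c assms(2,3)] assms(4) by simp
  moreover have "finite {k. c k \<noteq> \<zero>}" using assms(2,3) by (rule rev_finite_subset)
  ultimately show ?thesis unfolding homogeneous_parts_def using assms(1) by (intro the1_equality) auto
qed

lemma homogeneous_parts_add:
  assumes x: "x \<in> carrier M" and y: "y \<in> carrier M"
  shows "homogeneous_parts M B (x \<oplus> y) = (\<lambda>k. homogeneous_parts M B x k \<oplus> homogeneous_parts M B y k)"
proof (rule homogeneous_parts_eqI)
  let ?c = "homogeneous_parts M B"
  let ?F = "{k. ?c x k \<noteq> \<zero>} \<union> {k. ?c y k \<noteq> \<zero>}"
  have carr: "?c x k \<in> carrier M" "?c y k \<in> carrier M" for k
    using homogeneous_parts(1)[OF x] homogeneous_parts(1)[OF y] grading_component_carrier by blast+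
  show "?c x k \<oplus> ?c y k \<in> B k" for k
    using homogeneous_parts(1)[OF x] homogeneous_parts(1)[OF y]
    by (intro additive_subgroup.a_closed[OF grading_component])
  show fin: "finite ?F" using homogeneous_parts(2) x y by blast
  show "{k. ?c x k \<oplus> ?c y k \<noteq> \<zero>} \<subseteq> ?F" by auto
  have "x = (\<Oplus>k \<in> ?F. ?c x k)" "y = (\<Oplus>k \<in> ?F. ?c y k)"
    using finsum_support[OF carr(1) fin] finsum_support[OF carr(2) fin]
      homogeneous_parts(3)[OF x] homogeneous_parts(3)[OF y] by auto
  then show "x \<oplus> y = (\<Oplus>k \<in> ?F. ?c x k \<oplus> ?c y k)"
    using carr by (subst finsum_addf) auto
qed

lemma homogeneous_parts_homogeneous:
  assumes "x \<in> B j"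
  shows "homogeneous_parts M B x = (\<lambda>k. if k = j then x else \<zero>)"
proof (rule homogeneous_parts_eqI)
  show "(if k = j then x else \<zero>) \<in> B k" for k
    using assms additive_subgroup.zero_closed[OF grading_component] by auto
  show "x = (\<Oplus>k \<in> {j}. if k = j then x else \<zero>)"
    using grading_component_carrier[OF assms] by simp
qed auto

text \<open>The universal property of the direct sum: an additive map may be prescribed on each degree
  separately.\<close>
lemma additive_family_extends:
  assumes N: "abelian_group N"
    and closed: "\<And>k x. x \<in> B k \<Longrightarrow> h k x \<in> carrier N"
    and additive: "\<And>k x y. \<lbrakk>x \<in> B k; y \<in> B k\<rbrakk> \<Longrightarrow> h k (x \<oplus> y) = h k x \<oplus>\<^bsub>N\<^esub> h k y"
  shows "\<exists>f \<in> hom (add_monoid M) (add_monoid N). \<forall>k. \<forall>x \<in> B k. f x = h k x"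
proof -
  interpret N: abelian_group N by (rule N)
  let ?c = "homogeneous_parts M B"
  define f where "f x = (\<Oplus>\<^bsub>N\<^esub>k \<in> {k. ?c x k \<noteq> \<zero>}. h k (?c x k))" for x
  have zeroB: "\<zero> \<in> B k" for k by (rule additive_subgroup.zero_closed[OF grading_component])
  have h0: "h k \<zero> = \<zero>\<^bsub>N\<^esub>" for k
    using additive[OF zeroB zeroB] closed[OF zeroB] by (metis N.add.l_cancel_one l_zero zero_closed)
  have cB: "?c x k \<in> B k" if "x \<in> carrier M" for x k using that by (rule homogeneous_parts(1))
  have f_eq: "f x = (\<Oplus>\<^bsub>N\<^esub>k \<in> F. h k (?c x k))"
    if "x \<in> carrier M" "finite F" "{k. ?c x k \<noteq> \<zero>} \<subseteq> F" for x F
    unfolding f_def using that h0 closed[OF cB]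
    by (intro N.add.finprod_mono_neutral_cong_left) auto
  have "f (x \<oplus> y) = f x \<oplus>\<^bsub>N\<^esub> f y" if x: "x \<in> carrier M" and y: "y \<in> carrier M" for x y
  proof -
    let ?F = "{k. ?c x k \<noteq> \<zero>} \<union> {k. ?c y k \<noteq> \<zero>}"
    have fin: "finite ?F" using homogeneous_parts(2) x y by blast
    have "f (x \<oplus> y) = (\<Oplus>\<^bsub>N\<^esub>k \<in> ?F. h k (?c (x \<oplus> y) k))"
      using x y fin by (intro f_eq) (auto simp: homogeneous_parts_add)
    also have "\<dots> = (\<Oplus>\<^bsub>N\<^esub>k \<in> ?F. h k (?c x k) \<oplus>\<^bsub>N\<^esub> h k (?c y k))"
      using x y by (simp add: homogeneous_parts_add additive cB)
    also have "\<dots> = (\<Oplus>\<^bsub>N\<^esub>k \<in> ?F. h k (?c x k)) \<oplus>\<^bsub>N\<^esub> (\<Oplus>\<^bsub>N\<^esub>k \<in> ?F. h k (?c y k))"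
      using closed[OF cB[OF x]] closed[OF cB[OF y]] by (intro N.finsum_addf) auto
    also have "\<dots> = f x \<oplus>\<^bsub>N\<^esub> f y"
      using f_eq[OF x fin] f_eq[OF y fin] by simp
    finally show ?thesis .
  qed
  moreover have "f x \<in> carrier N" if "x \<in> carrier M" for x
    unfolding f_def using closed[OF cB[OF that]] by (intro N.finsum_closed) auto
  ultimately have "f \<in> hom (add_monoid M) (add_monoid N)" by (auto simp: hom_def)
  moreover have "f x = h k x" if "x \<in> B k" for k x
  proof -
    have "f x = (\<Oplus>\<^bsub>N\<^esub>j \<in> {k}. h j (?c x j))"
      using that by (intro f_eq grading_component_carrier[OF that]) (auto simp: homogeneous_parts_homogeneous)
    also have "\<dots> = h k x" using that closed[OF that] by (simp add: homogeneous_parts_homogeneous)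
    finally show ?thesis .
  qed
  ultimately show ?thesis by blast
qed

end

lemma grading_induct [consumes 3, case_names homogeneous add]:
  fixes M (structure)
  assumes M: "abelian_group M" and grading: "is_grading M B" and x: "x \<in> carrier M"
    and homogeneous: "\<And>k x. x \<in> B k \<Longrightarrow> P x"
    and add: "\<And>x y. \<lbrakk>x \<in> carrier M; y \<in> carrier M; P x; P y\<rbrakk> \<Longrightarrow> P (x \<oplus> y)"
  shows "P x"
proof -
  interpret abelian_group M by (rule M)
  let ?c = "homogeneous_parts M B x"
  have c: "?c k \<in> B k" for k using M grading x by (rule homogeneous_parts(1))
  have "P (\<Oplus>k \<in> F. ?c k)" if "finite F" for F
    using that
  proof induction
    case empty
    show ?case using homogeneous additive_subgroup.zero_closed[OF grading_component[OF M grading]] by simp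
  next
    case (insert k F)
    have carr: "?c \<in> F \<rightarrow> carrier M" "?c k \<in> carrier M" using grading_component_carrier[OF M grading c] by auto
    then show ?case using insert homogeneous[OF c] add by (simp add: finsum_closed)
  qed
  then show ?thesis using homogeneous_parts(2,3)[OF M grading x] by metis
qed


section \<open>Components as modules over the base ring\<close>

lemma module_hom_simps:
  "f \<in> module_hom R M N \<longleftrightarrow>
    (\<forall>x \<in> carrier M. f x \<in> carrier N) \<and>
    (\<forall>x \<in> carrier M. \<forall>y \<in> carrier M. f (x \<oplus>\<^bsub>M\<^esub> y) = f x \<oplus>\<^bsub>N\<^esub> f y) \<and>
    (\<forall>r \<in> carrier R. \<forall>x \<in> carrier M. f (r \<odot>\<^bsub>M\<^esub> x) = r \<odot>\<^bsub>N\<^esub> f x)"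
  by (auto simp: module_hom_def hom_def Pi_iff)

lemma component_simps [simp]:
  "carrier (component R A k) = A k" "\<zero>\<^bsub>component R A k\<^esub> = \<zero>\<^bsub>R\<^esub>"
  "x \<oplus>\<^bsub>component R A k\<^esub> y = x \<oplus>\<^bsub>R\<^esub> y" "c \<odot>\<^bsub>component R A k\<^esub> x = c \<odot>\<^bsub>R\<^esub> x"
  by (simp_all add: component_def)

lemma regular_module_simps [simp]:
  "carrier (regular_module R) = carrier R" "\<zero>\<^bsub>regular_module R\<^esub> = \<zero>\<^bsub>R\<^esub>"
  "x \<oplus>\<^bsub>regular_module R\<^esub> y = x \<oplus>\<^bsub>R\<^esub> y" "r \<odot>\<^bsub>regular_module R\<^esub> x = r \<otimes>\<^bsub>R\<^esub> x"
  by (simp_all add: regular_module_def)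

text \<open>The degree \<open>k\<close> part of a graded \<open>R\<close>-module, as a module over the base ring \<open>K\<close> of \<open>R\<close>: a scalar
  \<open>c\<close> acts through its image \<open>c \<odot> \<one>\<close> in \<open>R\<close>, which has degree \<open>0\<close> and hence preserves the
  degree.\<close>

definition component_over_base ::
  "('k, 'a, 'r) module_scheme \<Rightarrow> ('a, 'b, 'm) module_scheme \<Rightarrow> (int \<Rightarrow> 'b set) \<Rightarrow> int \<Rightarrow> ('k, 'b) module"
  where "component_over_base R M E k =
    \<lparr>carrier = E k, monoid.mult = undefined, one = undefined, zero = zero M, add = add M,
     smult = (\<lambda>c x. (c \<odot>\<^bsub>R\<^esub> \<one>\<^bsub>R\<^esub>) \<odot>\<^bsub>M\<^esub> x)\<rparr>"

lemma component_over_base_simps [simp]: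
  "carrier (component_over_base R M E k) = E k"
  "\<zero>\<^bsub>component_over_base R M E k\<^esub> = \<zero>\<^bsub>M\<^esub>"
  "x \<oplus>\<^bsub>component_over_base R M E k\<^esub> y = x \<oplus>\<^bsub>M\<^esub> y"
  "c \<odot>\<^bsub>component_over_base R M E k\<^esub> x = (c \<odot>\<^bsub>R\<^esub> \<one>\<^bsub>R\<^esub>) \<odot>\<^bsub>M\<^esub> x"
  by (simp_all add: component_over_base_def)

lemma additive_subgroup_abelian_group:
  assumes M: "abelian_group M" and B: "additive_subgroup B M"
    and N: "carrier N = B" "\<zero>\<^bsub>N\<^esub> = \<zero>\<^bsub>M\<^esub>" "add N = add M"
  shows "abelian_group N"
proof -
  interpret M: abelian_group M by (rule M)
  interpret B: additive_subgroup B M by (rule B)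
  note sub = subsetD[OF B.a_subset]
  show ?thesis
  proof (rule abelian_groupI)
    fix x assume x: "x \<in> carrier N"
    show "\<exists>y \<in> carrier N. y \<oplus>\<^bsub>N\<^esub> x = \<zero>\<^bsub>N\<^esub>"
      using x B.a_inv_closed[of x] sub[of x] unfolding N by (auto intro!: bexI[of _ "\<ominus>\<^bsub>M\<^esub> x"] simp: M.l_neg)
  qed (use sub in \<open>auto simp: N M.a_assoc intro: M.a_comm\<close>)
qed

lemma component_module:
  assumes "graded_commutative_algebra K R A"
  shows "module K (component R A k)"
proof -
  interpret R: graded_commutative_algebra K R A by (rule assms)
  note carr = grading_component_carrier[OF R.K.M.abelian_group_axioms R.grading]
  show ?thesis
  proof (rule moduleI)
    show "cring K" by (rule R.K.R.cring_axioms)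
    show "abelian_group (component R A k)"
      by (rule additive_subgroup_abelian_group[OF R.K.M.abelian_group_axioms
            grading_component[OF R.K.M.abelian_group_axioms R.grading]]) (simp_all add: component_def)
  qed (use carr in \<open>auto simp: R.smult_degree R.K.smult_l_distr R.K.smult_r_distr R.K.smult_assoc1\<close>)
qed

lemma base_scalar:
  assumes "graded_commutative_algebra K R A"
  shows "c \<in> carrier K \<Longrightarrow> c \<odot>\<^bsub>R\<^esub> \<one>\<^bsub>R\<^esub> \<in> A 0"
    and "c \<in> carrier K \<Longrightarrow> c \<odot>\<^bsub>R\<^esub> \<one>\<^bsub>R\<^esub> \<in> carrier R"
    and "\<lbrakk>c \<in> carrier K; x \<in> carrier R\<rbrakk> \<Longrightarrow> (c \<odot>\<^bsub>R\<^esub> \<one>\<^bsub>R\<^esub>) \<otimes>\<^bsub>R\<^esub> x = c \<odot>\<^bsub>R\<^esub> x"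
proof -
  interpret R: graded_commutative_algebra K R A by (rule assms)
  interpret ring R by (rule R.ring_axioms)
  show "c \<in> carrier K \<Longrightarrow> c \<odot>\<^bsub>R\<^esub> \<one>\<^bsub>R\<^esub> \<in> A 0" using R.one_degree by (rule R.smult_degree[rotated])
  show "c \<in> carrier K \<Longrightarrow> c \<odot>\<^bsub>R\<^esub> \<one>\<^bsub>R\<^esub> \<in> carrier R" by (simp add: R.K.smult_closed)
  show "\<lbrakk>c \<in> carrier K; x \<in> carrier R\<rbrakk> \<Longrightarrow> (c \<odot>\<^bsub>R\<^esub> \<one>\<^bsub>R\<^esub>) \<otimes>\<^bsub>R\<^esub> x = c \<odot>\<^bsub>R\<^esub> x"
    by (simp add: R.smult_mult_left)
qed

lemma component_over_base_module:
  assumes alg: "graded_commutative_algebra K R A" and M: "graded_module R A M E"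
  shows "module K (component_over_base R M E k)"
proof -
  interpret R: graded_commutative_algebra K R A by (rule alg)
  interpret M: graded_module R A M E by (rule M)
  note carr = grading_component_carrier[OF M.M.abelian_group_axioms M.module_grading]
  note base = base_scalar[OF alg]
  show ?thesis
  proof (rule moduleI)
    show "cring K" by (rule R.K.R.cring_axioms)
    show "abelian_group (component_over_base R M E k)"
      by (rule additive_subgroup_abelian_group[OF M.M.abelian_group_axioms
            grading_component[OF M.M.abelian_group_axioms M.module_grading]])
        (simp_all add: component_over_base_def)
  next
    fix a x assume "a \<in> carrier K" "x \<in> carrier (component_over_base R M E k)"
    then show "a \<odot>\<^bsub>component_over_base R M E k\<^esub> x \<in> carrier (component_over_base R M E k)"
      using M.smult_degree[OF base(1), of a x k] by simp
  next
    fix a b x assume "a \<in> carrier K" "b \<in> carrier K" "x \<in> carrier (component_over_base R M E k)"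
    then show "(a \<oplus>\<^bsub>K\<^esub> b) \<odot>\<^bsub>component_over_base R M E k\<^esub> x =
      a \<odot>\<^bsub>component_over_base R M E k\<^esub> x \<oplus>\<^bsub>component_over_base R M E k\<^esub>
      b \<odot>\<^bsub>component_over_base R M E k\<^esub> x"
      using carr base(2) by (simp add: R.K.smult_l_distr M.smult_l_distr)
  next
    fix a x y assume "a \<in> carrier K" "x \<in> carrier (component_over_base R M E k)"
      "y \<in> carrier (component_over_base R M E k)"
    then show "a \<odot>\<^bsub>component_over_base R M E k\<^esub> (x \<oplus>\<^bsub>component_over_base R M E k\<^esub> y) =
      a \<odot>\<^bsub>component_over_base R M E k\<^esub> x \<oplus>\<^bsub>component_over_base R M E k\<^esub>
      a \<odot>\<^bsub>component_over_base R M E k\<^esub> y"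
      using carr base(2) by (simp add: M.smult_r_distr)
  next
    fix a b x assume ab: "a \<in> carrier K" "b \<in> carrier K" and x: "x \<in> carrier (component_over_base R M E k)"
    have "(a \<otimes>\<^bsub>K\<^esub> b) \<odot>\<^bsub>R\<^esub> \<one>\<^bsub>R\<^esub> = (a \<odot>\<^bsub>R\<^esub> \<one>\<^bsub>R\<^esub>) \<otimes>\<^bsub>R\<^esub> (b \<odot>\<^bsub>R\<^esub> \<one>\<^bsub>R\<^esub>)"
      using ab base(2) by (simp add: base(3) R.K.smult_assoc1)
    then show "(a \<otimes>\<^bsub>K\<^esub> b) \<odot>\<^bsub>component_over_base R M E k\<^esub> x =
      a \<odot>\<^bsub>component_over_base R M E k\<^esub> (b \<odot>\<^bsub>component_over_base R M E k\<^esub> x)"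
      using ab x carr base(2) by (simp add: M.smult_assoc1)
  next
    fix x assume "x \<in> carrier (component_over_base R M E k)"
    then show "\<one>\<^bsub>K\<^esub> \<odot>\<^bsub>component_over_base R M E k\<^esub> x = x"
      using carr by (simp add: M.smult_one)
  qed
qed

lemma is_grading_cong:
  assumes "carrier N = carrier M" "\<zero>\<^bsub>N\<^esub> = \<zero>\<^bsub>M\<^esub>" "add N = add M"
  shows "is_grading N A \<longleftrightarrow> is_grading M A"
proof -
  have "additive_subgroup B N \<longleftrightarrow> additive_subgroup B M" for B
    by (simp add: additive_subgroup_def subgroup_def m_inv_def assms)
  moreover have "finsum N c S = finsum M c S" for c and S :: "int set"
    by (simp add: finsum_def finprod_def assms)
  ultimately show ?thesis by (simp add: is_grading_def assms)
qed

lemma regular_graded_module: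
  assumes "graded_ring R A"
  shows "graded_module R A (regular_module R) A"
proof -
  interpret graded_ring R A by (rule assms)
  have grp: "abelian_group (regular_module R)"
    by (rule additive_subgroup_abelian_group[OF abelian_group_axioms,
          where B = "carrier R"]) (auto simp: regular_module_def intro!: additive_subgroupI add.subgroup_self)
  have "is_grading (regular_module R) A"
    using grading is_grading_cong[of "regular_module R" R A] by (simp add: regular_module_def)
  with grp show ?thesis
    by (intro graded_module.intro left_module.intro left_module_axioms.intro
        graded_module_axioms.intro assms ring_axioms)
      (auto simp: l_distr r_distr m_assoc mult_degree)
qed

section \<open>Algebras with a perfect pairing into one degree\<close>

text \<open>Self-duality with the dualizing module \<open>\<rat>\<^sub>p/\<int>\<^sub>p\<close> replaced by \<open>A d\<close> itself: multiplication
  \<open>A (d - k) \<times> A k \<rightarrow> A d\<close> identifies \<open>A (d - k)\<close> with the linear maps from \<open>A k\<close> to \<open>A d\<close>. Transport along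
  \<open>\<zeta>\<close> gives the two notions the same content, and this one is free of \<open>p\<close>-adic numbers.\<close>

locale perfect_graded_algebra = graded_commutative_algebra K R A
  for K :: "('k, 'r) ring_scheme" and R :: "('k, 'a) module" (structure) and A +
  fixes d :: int
  assumes represent: "\<psi> \<in> module_hom K (component R A k) (component R A d) \<Longrightarrow>
      \<exists>a \<in> A (d - k). \<forall>b \<in> A k. a \<otimes> b = \<psi> b"
    and nondegenerate: "\<lbrakk>a \<in> A (d - k); \<And>b. b \<in> A k \<Longrightarrow> a \<otimes> b = \<zero>\<rbrakk> \<Longrightarrow> a = \<zero>"
begin

lemma graded_commutative_algebra: "graded_commutative_algebra K R A" ..

lemmas R_abelian_group = K.M.abelian_group_axioms

lemma degree_carrier: "a \<in> A k \<Longrightarrow> a \<in> carrier R"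
  by (rule grading_component_carrier[OF R_abelian_group grading])

text \<open>A left module calls for products \<open>b \<otimes> a\<close> with the scalar \<open>b\<close> on the left, whereas the duality maps put
  \<open>a\<close> first. Since the degrees of \<open>a\<close> and \<open>b\<close> are fixed, graded commutativity exchanges the two forms
  at the cost of one constant sign, so both properties of the pairing carry over.\<close>

lemma left_nondegenerate:
  assumes a: "a \<in> A (d - k)" "a' \<in> A (d - k)"
    and eq: "\<And>b. b \<in> A k \<Longrightarrow> b \<otimes> a = b \<otimes> a'"
  shows "a = a'"
proof -
  note Asub = grading_component[OF R_abelian_group grading]
  have diff: "a \<ominus> a' \<in> A (d - k)"
    unfolding K.M.minus_eq using a
    by (intro additive_subgroup.a_closed[OF Asub] additive_subgroup.a_inv_closed[OF Asub])
  have "a \<ominus> a' = \<zero>"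
  proof (rule nondegenerate[OF diff])
    fix b assume b: "b \<in> A k"
    have "b \<otimes> (a \<ominus> a') = \<zero>"
      using eq[OF b] degree_carrier[OF b] degree_carrier[OF a(1)] degree_carrier[OF a(2)]
      by (simp add: K.M.minus_eq r_distr r_minus K.M.r_neg)
    then show "(a \<ominus> a') \<otimes> b = \<zero>"
      using graded_commute[OF b diff] by (simp split: if_splits)
  qed
  then show ?thesis
    using degree_carrier[OF a(1)] degree_carrier[OF a(2)]
    by (metis K.M.minus_eq K.M.minus_equality K.M.minus_minus K.M.a_inv_closed)
qed

lemma left_represent:
  assumes \<psi>: "\<psi> \<in> module_hom K (component R A k) (component R A d)"
  shows "\<exists>a \<in> A (d - k). \<forall>b \<in> A k. b \<otimes> a = \<psi> b"
proof -
  obtain a where a: "a \<in> A (d - k)" "\<And>b. b \<in> A k \<Longrightarrow> a \<otimes> b = \<psi> b" using represent[OF \<psi>] by blast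
  show ?thesis
  proof (cases "even ((d - k) * k)")
    case True
    then show ?thesis using a graded_commute[OF a(1)] by (intro bexI[of _ a]) auto
  next
    case False
    have "b \<otimes> (\<ominus> a) = \<psi> b" if b: "b \<in> A k" for b
    proof -
      have carr: "a \<in> carrier R" "b \<in> carrier R" using a(1) b by (auto intro: degree_carrier)
      have "b \<otimes> (\<ominus> a) = \<ominus> (b \<otimes> a)" using carr by (simp add: r_minus)
      also have "b \<otimes> a = \<ominus> (a \<otimes> b)" using graded_commute[OF a(1) b] False by simp
      also have "\<ominus> \<dots> = a \<otimes> b" using carr by (simp add: K.M.minus_minus)
      finally show ?thesis using a(2)[OF b] by simp
    qed
    moreover have "\<ominus> a \<in> A (d - k)"
      using a(1) by (rule additive_subgroup.a_inv_closed[OF grading_component[OF R_abelian_group grading]])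
    ultimately show ?thesis by blast
  qed
qed

text \<open>The adjunction behind the theorem: graded \<open>R\<close>-linear maps \<open>M \<rightarrow> R\<close> come from \<open>K\<close>-linear
  functionals \<open>\<phi>\<close> on the degree \<open>d\<close> part of \<open>M\<close>. For homogeneous \<open>x\<close>, perfectness of the
  pairing yields a unique \<open>h x\<close> with \<open>b \<otimes> h x = \<phi> (b x)\<close> for all \<open>b\<close> of complementary
  degree, and uniqueness makes \<open>h\<close> additive and \<open>R\<close>-linear.\<close>

lemma hom_from_functional:
  assumes M: "graded_module R A M E"
    and \<phi>: "\<phi> \<in> module_hom K (component_over_base R M E d) (component R A d)"
  obtains h where "h \<in> graded_module_hom R M E (regular_module R) A"
    and "\<And>k x b. \<lbrakk>x \<in> E k; b \<in> A (d - k)\<rbrakk> \<Longrightarrow> b \<otimes> h x = \<phi> (b \<odot>\<^bsub>M\<^esub> x)"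
proof -
  interpret M: graded_module R A M E by (rule M)
  note carrE = grading_component_carrier[OF M.M.abelian_group_axioms M.module_grading]
  note base = base_scalar[OF graded_commutative_algebra]
  note \<phi>' = \<phi>[unfolded module_hom_simps component_simps component_over_base_simps]
  have deg: "b \<odot>\<^bsub>M\<^esub> x \<in> E d" if "x \<in> E k" "b \<in> A (d - k)" for k x b
    using M.smult_degree[OF that(2,1)] by simp
  have "\<exists>a \<in> A k. \<forall>b \<in> A (d - k). b \<otimes> a = \<phi> (b \<odot>\<^bsub>M\<^esub> x)" if x: "x \<in> E k" for k x
  proof -
    have "(\<lambda>b. \<phi> (b \<odot>\<^bsub>M\<^esub> x)) \<in> module_hom K (component R A (d - k)) (component R A d)"
      unfolding module_hom_simps component_simps
    proof (intro conjI ballI)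
      fix b assume b: "b \<in> A (d - k)"
      show "\<phi> (b \<odot>\<^bsub>M\<^esub> x) \<in> A d" using \<phi>' deg[OF x b] by blast
      fix b' assume b': "b' \<in> A (d - k)"
      show "\<phi> ((b \<oplus> b') \<odot>\<^bsub>M\<^esub> x) = \<phi> (b \<odot>\<^bsub>M\<^esub> x) \<oplus> \<phi> (b' \<odot>\<^bsub>M\<^esub> x)"
        using \<phi>' deg[OF x b] deg[OF x b'] degree_carrier[OF b] degree_carrier[OF b'] carrE[OF x]
        by (simp add: M.smult_l_distr)
    next
      fix c b assume c: "c \<in> carrier K" and b: "b \<in> A (d - k)"
      have "(c \<odot> b) \<odot>\<^bsub>M\<^esub> x = (c \<odot> \<one>) \<odot>\<^bsub>M\<^esub> (b \<odot>\<^bsub>M\<^esub> x)"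
        unfolding base(3)[OF c degree_carrier[OF b], symmetric]
        using base(2)[OF c] degree_carrier[OF b] carrE[OF x] by (rule M.smult_assoc1)
      then show "\<phi> ((c \<odot> b) \<odot>\<^bsub>M\<^esub> x) = c \<odot> \<phi> (b \<odot>\<^bsub>M\<^esub> x)"
        using \<phi>' deg[OF x b] c by simp
    qed
    from left_represent[OF this] show ?thesis by simp
  qed
  then have "\<forall>k. \<forall>x \<in> E k. \<exists>a. a \<in> A k \<and> (\<forall>b \<in> A (d - k). b \<otimes> a = \<phi> (b \<odot>\<^bsub>M\<^esub> x))" by blast
  then have "\<forall>k. \<exists>h. \<forall>x \<in> E k. h x \<in> A k \<and> (\<forall>b \<in> A (d - k). b \<otimes> h x = \<phi> (b \<odot>\<^bsub>M\<^esub> x))"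
    by (intro allI bchoice) blast
  then obtain h0 where
    "\<forall>k. \<forall>x \<in> E k. h0 k x \<in> A k \<and> (\<forall>b \<in> A (d - k). b \<otimes> h0 k x = \<phi> (b \<odot>\<^bsub>M\<^esub> x))"
    by (rule choice[THEN exE])
  then have h0: "\<And>k x. x \<in> E k \<Longrightarrow> h0 k x \<in> A k"
      "\<And>k x b. \<lbrakk>x \<in> E k; b \<in> A (d - k)\<rbrakk> \<Longrightarrow> b \<otimes> h0 k x = \<phi> (b \<odot>\<^bsub>M\<^esub> x)"
    by blast+
  have unique: "a = a'"
    if "a \<in> A k" "a' \<in> A k" "\<And>b. b \<in> A (d - k) \<Longrightarrow> b \<otimes> a = b \<otimes> a'" for k a a'
    using left_nondegenerate[of a "d - k" a'] that by simp
  have E_add: "x \<oplus>\<^bsub>M\<^esub> y \<in> E k" if "x \<in> E k" "y \<in> E k" for k x y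
    using additive_subgroup.a_closed[OF grading_component[OF M.M.abelian_group_axioms M.module_grading] that] .
  have A_add: "x \<oplus> y \<in> A k" if "x \<in> A k" "y \<in> A k" for k x y
    using additive_subgroup.a_closed[OF grading_component[OF R_abelian_group grading] that] .
  have "h0 k (x \<oplus>\<^bsub>M\<^esub> y) = h0 k x \<oplus> h0 k y" if x: "x \<in> E k" and y: "y \<in> E k" for k x y
  proof (rule unique)
    fix b assume b: "b \<in> A (d - k)"
    have "b \<otimes> h0 k (x \<oplus>\<^bsub>M\<^esub> y) = \<phi> (b \<odot>\<^bsub>M\<^esub> x \<oplus>\<^bsub>M\<^esub> b \<odot>\<^bsub>M\<^esub> y)"
      using x y b degree_carrier[OF b] carrE by (simp add: h0(2) E_add M.smult_r_distr)
    also have "\<dots> = b \<otimes> h0 k x \<oplus> b \<otimes> h0 k y"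
      using \<phi>' deg[OF x b] deg[OF y b] h0(2) x y b by simp
    also have "\<dots> = b \<otimes> (h0 k x \<oplus> h0 k y)"
      using degree_carrier[OF b] degree_carrier[OF h0(1)] x y by (simp add: r_distr)
    finally show "b \<otimes> h0 k (x \<oplus>\<^bsub>M\<^esub> y) = b \<otimes> (h0 k x \<oplus> h0 k y)" .
  qed (use h0(1) x y E_add A_add in auto)
  then have "\<exists>h \<in> hom (add_monoid M) (add_monoid R). \<forall>k. \<forall>x \<in> E k. h x = h0 k x"
    by (intro additive_family_extends[OF M.M.abelian_group_axioms M.module_grading R_abelian_group]
        degree_carrier[OF h0(1)])
  then obtain h where h: "h \<in> hom (add_monoid M) (add_monoid R)" "\<And>k x. x \<in> E k \<Longrightarrow> h x = h0 k x"
    by blast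
  have h_carr: "h x \<in> carrier R" if "x \<in> carrier M" for x
    using h(1) that by (auto simp: hom_def)
  have h_add: "h (x \<oplus>\<^bsub>M\<^esub> y) = h x \<oplus> h y" if "x \<in> carrier M" "y \<in> carrier M" for x y
    using h(1) that by (simp add: hom_def)
  have h_smult_homogeneous: "h (r \<odot>\<^bsub>M\<^esub> x) = r \<otimes> h x" if r: "r \<in> A i" and x: "x \<in> E j" for r x i j
  proof -
    have rx: "r \<odot>\<^bsub>M\<^esub> x \<in> E (i + j)" using r x by (rule M.smult_degree)
    have "h0 (i + j) (r \<odot>\<^bsub>M\<^esub> x) = r \<otimes> h0 j x"
    proof (rule unique)
      fix b assume b: "b \<in> A (d - (i + j))"
      then have br: "b \<otimes> r \<in> A (d - j)" using mult_degree[OF b r] by (simp add: algebra_simps)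
      have "b \<otimes> h0 (i + j) (r \<odot>\<^bsub>M\<^esub> x) = \<phi> (b \<odot>\<^bsub>M\<^esub> (r \<odot>\<^bsub>M\<^esub> x))" using rx b by (rule h0(2))
      also have "\<dots> = \<phi> ((b \<otimes> r) \<odot>\<^bsub>M\<^esub> x)"
        using degree_carrier[OF b] degree_carrier[OF r] carrE[OF x] by (simp add: M.smult_assoc1)
      also have "\<dots> = b \<otimes> r \<otimes> h0 j x" using x br by (rule h0(2)[symmetric])
      also have "\<dots> = b \<otimes> (r \<otimes> h0 j x)"
        using degree_carrier[OF b] degree_carrier[OF r] degree_carrier[OF h0(1)[OF x]] by (rule m_assoc)
      finally show "b \<otimes> h0 (i + j) (r \<odot>\<^bsub>M\<^esub> x) = b \<otimes> (r \<otimes> h0 j x)" .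
    qed (use h0(1) rx x r mult_degree in auto)
    then show ?thesis using h(2) rx x by simp
  qed
  have linear_in_scalar: "h (r \<odot>\<^bsub>M\<^esub> x) = r \<otimes> h x" if "r \<in> carrier R" and x: "x \<in> E j" for r x j
    using R_abelian_group grading \<open>r \<in> carrier R\<close>
  proof (induction r rule: grading_induct)
    case (homogeneous i r)
    then show ?case using x by (rule h_smult_homogeneous)
  next
    case (add r s)
    then show ?case
      using carrE[OF x] h_carr by (simp add: M.smult_l_distr h_add M.smult_closed l_distr)
  qed
  have "h (r \<odot>\<^bsub>M\<^esub> x) = r \<otimes> h x" if r: "r \<in> carrier R" and "x \<in> carrier M" for r x
    using M.M.abelian_group_axioms M.module_grading \<open>x \<in> carrier M\<close>
  proof (induction x rule: grading_induct)
    case (homogeneous j x)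
    then show ?case by (rule linear_in_scalar[OF r])
  next
    case (add x y)
    then show ?case
      using r h_carr by (simp add: M.smult_r_distr h_add M.smult_closed r_distr)
  qed
  then have "h \<in> graded_module_hom R M E (regular_module R) A"
    unfolding graded_module_hom_def module_hom_simps using h_carr h_add h(2) h0(1) by auto
  moreover have "b \<otimes> h x = \<phi> (b \<odot>\<^bsub>M\<^esub> x)" if "x \<in> E k" "b \<in> A (d - k)" for k x b
    using h0(2)[OF that] h(2)[OF that(1)] by simp
  ultimately show ?thesis by (rule that)
qed

text \<open>A map \<open>g\<close> from \<open>L\<close> to \<open>R\<close> is determined by its degree \<open>d\<close> part, which is a functional over
  \<open>K\<close>. That functional extends along \<open>f\<close> because \<open>A d\<close> is an injective \<open>K\<close>-module, and the extension
  comes from a graded \<open>R\<close>-linear map \<open>h\<close>. Both \<open>h \<circ> f\<close> and \<open>g\<close> have the same pairings with \<open>R\<close>,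
  hence agree.\<close>

lemma self_injective:
  assumes principal: "\<And>I. ideal I K \<Longrightarrow> \<exists>a \<in> carrier K. I = PIdl\<^bsub>K\<^esub> a"
    and divisible: "\<And>c t. \<lbrakk>c \<in> carrier K - {\<zero>\<^bsub>K\<^esub>}; t \<in> A d\<rbrakk> \<Longrightarrow> \<exists>s \<in> A d. c \<odot> s = t"
  shows "self_injective TYPE('l) TYPE('m) R A"
  unfolding self_injective_def graded_injective_def
proof (intro conjI allI impI)
  show "graded_module R A (regular_module R) A" by (rule regular_graded_module) unfold_locales
next
  fix L :: "('a, 'l) module" and D and M :: "('a, 'm) module" and E f g
  assume "graded_module R A L D \<and> graded_module R A M E \<and> f \<in> graded_module_hom R L D M E \<and>
    inj_on f (carrier L) \<and> g \<in> graded_module_hom R L D (regular_module R) A"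
  then have L: "graded_module R A L D" and M: "graded_module R A M E"
    and f: "f \<in> graded_module_hom R L D M E" and inj: "inj_on f (carrier L)"
    and g: "g \<in> graded_module_hom R L D (regular_module R) A" by auto
  interpret L: graded_module R A L D by (rule L)
  interpret M: graded_module R A M E by (rule M)
  note carrD = grading_component_carrier[OF L.M.abelian_group_axioms L.module_grading]
  note base = base_scalar[OF graded_commutative_algebra]
  have fD: "f x \<in> E k" and gD: "g x \<in> A k" if "x \<in> D k" for k x
    using f g that unfolding graded_module_hom_def by blast+
  have f_add: "f (x \<oplus>\<^bsub>L\<^esub> y) = f x \<oplus>\<^bsub>M\<^esub> f y" and g_add: "g (x \<oplus>\<^bsub>L\<^esub> y) = g x \<oplus> g y"
    if "x \<in> carrier L" "y \<in> carrier L" for x y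
    using f g that by (auto simp: graded_module_hom_def module_hom_simps)
  have f_smult: "f (r \<odot>\<^bsub>L\<^esub> x) = r \<odot>\<^bsub>M\<^esub> f x" and g_smult: "g (r \<odot>\<^bsub>L\<^esub> x) = r \<otimes> g x"
    if "r \<in> carrier R" "x \<in> carrier L" for r x
    using f g that by (auto simp: graded_module_hom_def module_hom_simps)
  have f_carr: "f x \<in> carrier M" and g_carr: "g x \<in> carrier R" if "x \<in> carrier L" for x
    using f g that by (auto simp: graded_module_hom_def module_hom_simps)
  have f0: "f \<zero>\<^bsub>L\<^esub> = \<zero>\<^bsub>M\<^esub>"
    using f_add[of "\<zero>\<^bsub>L\<^esub>" "\<zero>\<^bsub>L\<^esub>"] f_carr by (metis L.M.l_zero L.M.zero_closed M.M.add.l_cancel_one)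
  have g0: "g \<zero>\<^bsub>L\<^esub> = \<zero>"
    using g_add[of "\<zero>\<^bsub>L\<^esub>" "\<zero>\<^bsub>L\<^esub>"] g_carr by (metis L.M.l_zero L.M.zero_closed K.M.add.l_cancel_one)
  note Dsub = grading_component[OF L.M.abelian_group_axioms L.module_grading]
  let ?G = "(\<lambda>x. (f x, g x)) ` D d"
  have "linear_graph K (component_over_base R M E d) (component R A d) ?G"
    unfolding linear_graph_def component_simps component_over_base_simps
  proof (intro conjI allI ballI impI)
    show "?G \<subseteq> E d \<times> A d" using fD gD by auto
    show "(\<zero>\<^bsub>M\<^esub>, \<zero>) \<in> ?G"
      using f0 g0 additive_subgroup.zero_closed[OF Dsub] by (metis (mono_tags, lifting) image_eqI)
  next
    fix x s y t assume "(x, s) \<in> ?G" "(y, t) \<in> ?G"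
    then obtain u v where uv: "u \<in> D d" "v \<in> D d" "x = f u" "s = g u" "y = f v" "t = g v" by blast
    then have "(x \<oplus>\<^bsub>M\<^esub> y, s \<oplus> t) = (f (u \<oplus>\<^bsub>L\<^esub> v), g (u \<oplus>\<^bsub>L\<^esub> v))"
      using carrD by (simp add: f_add g_add)
    then show "(x \<oplus>\<^bsub>M\<^esub> y, s \<oplus> t) \<in> ?G"
      using additive_subgroup.a_closed[OF Dsub uv(1,2)] by (rule image_eqI)
  next
    fix c x t assume c: "c \<in> carrier K" and "(x, t) \<in> ?G"
    then obtain u where u: "u \<in> D d" "x = f u" "t = g u" by blast
    have "((c \<odot> \<one>) \<odot>\<^bsub>M\<^esub> x, c \<odot> t) = (f ((c \<odot> \<one>) \<odot>\<^bsub>L\<^esub> u), g ((c \<odot> \<one>) \<odot>\<^bsub>L\<^esub> u))"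
      using u carrD[OF u(1)] g_carr base(2)[OF c] c by (simp add: f_smult g_smult base(3))
    moreover have "(c \<odot> \<one>) \<odot>\<^bsub>L\<^esub> u \<in> D d" using L.smult_degree[OF base(1)[OF c] u(1)] by simp
    ultimately show "((c \<odot> \<one>) \<odot>\<^bsub>M\<^esub> x, c \<odot> t) \<in> ?G" by (rule image_eqI)
  next
    fix t assume "(\<zero>\<^bsub>M\<^esub>, t) \<in> ?G"
    then obtain u where u: "u \<in> D d" "f u = \<zero>\<^bsub>M\<^esub>" "t = g u" by force
    then have "u = \<zero>\<^bsub>L\<^esub>" using inj_onD[OF inj, of u "\<zero>\<^bsub>L\<^esub>"] carrD f0 by simp
    then show "t = \<zero>" using u g0 by simp
  qed
  note graph = this
  have divisible': "\<exists>s \<in> carrier (component R A d). c \<odot>\<^bsub>component R A d\<^esub> s = t"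
    if "c \<in> carrier K - {\<zero>\<^bsub>K\<^esub>}" "t \<in> carrier (component R A d)" for c t
    using divisible that by simp
  have "\<exists>\<phi> \<in> module_hom K (component_over_base R M E d) (component R A d). \<forall>(x, t) \<in> ?G. \<phi> x = t"
    by (rule linear_graph_extends_to_hom[OF component_over_base_module[OF graded_commutative_algebra M]
        component_module[OF graded_commutative_algebra] principal divisible' graph])
  then obtain \<phi> where \<phi>: "\<phi> \<in> module_hom K (component_over_base R M E d) (component R A d)"
    "\<And>x. x \<in> D d \<Longrightarrow> \<phi> (f x) = g x"
    by auto
  obtain h where h: "h \<in> graded_module_hom R M E (regular_module R) A"
    and h_pair: "\<And>k x b. \<lbrakk>x \<in> E k; b \<in> A (d - k)\<rbrakk> \<Longrightarrow> b \<otimes> h x = \<phi> (b \<odot>\<^bsub>M\<^esub> x)"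
    using hom_from_functional[OF M \<phi>(1)] by blast
  have h_add: "h (x \<oplus>\<^bsub>M\<^esub> y) = h x \<oplus> h y" if "x \<in> carrier M" "y \<in> carrier M" for x y
    using h that by (simp add: graded_module_hom_def module_hom_simps)
  have h_f_homogeneous: "h (f x) = g x" if x: "x \<in> D k" for k x
  proof (rule left_nondegenerate[of _ "d - k"])
    show "h (f x) \<in> A (d - (d - k))" using h fD[OF x] by (auto simp: graded_module_hom_def)
    show "g x \<in> A (d - (d - k))" using gD[OF x] by simp
    fix b assume b: "b \<in> A (d - k)"
    have bx: "b \<odot>\<^bsub>L\<^esub> x \<in> D d" using L.smult_degree[OF b x] by simp
    have "b \<otimes> h (f x) = \<phi> (b \<odot>\<^bsub>M\<^esub> f x)" using fD[OF x] b by (rule h_pair)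
    also have "b \<odot>\<^bsub>M\<^esub> f x = f (b \<odot>\<^bsub>L\<^esub> x)" using f_smult degree_carrier[OF b] carrD[OF x] by simp
    also have "\<phi> \<dots> = g (b \<odot>\<^bsub>L\<^esub> x)" using bx by (rule \<phi>(2))
    also have "\<dots> = b \<otimes> g x" using g_smult degree_carrier[OF b] carrD[OF x] by simp
    finally show "b \<otimes> h (f x) = b \<otimes> g x" .
  qed
  have "h (f x) = g x" if "x \<in> carrier L" for x
    using L.M.abelian_group_axioms L.module_grading that
  proof (induction x rule: grading_induct)
    case (homogeneous k x)
    then show ?case by (rule h_f_homogeneous)
  next
    case (add x y)
    then show ?case using f_carr by (simp add: f_add g_add h_add)
  qed
  then show "\<exists>h \<in> graded_module_hom R M E (regular_module R) A. \<forall>x \<in> carrier L. h (f x) = g x"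
    using h by blast
qed

end

section \<open>Pontrjagin self-dual algebras\<close>

text \<open>Composition with \<open>\<zeta>\<close> turns a linear map \<open>A k \<rightarrow> A d\<close> into an element of the Pontrjagin dual of
  \<open>A k\<close>, and \<open>\<zeta>\<close> is injective on \<open>A d\<close>; so bijectivity of the duality maps gives existence and
  uniqueness of the representing element.\<close>

lemma self_dual_perfect:
  fixes R :: "(padic_int, 'a) module"
  assumes alg: "graded_commutative_algebra (padic_integers p) R A"
    and \<zeta>: "\<zeta> \<in> module_iso (padic_integers p) (component R A d) (Qp_mod_Zp p)"
    and dual: "pontrjagin_self_dual p R A d \<zeta>"
  shows "perfect_graded_algebra (padic_integers p) R A d"
proof -
  interpret R: graded_commutative_algebra "padic_integers p" R A by (rule alg)
  let ?Z = "padic_integers p"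
  note carr = grading_component_carrier[OF R.K.M.abelian_group_axioms R.grading]
  have \<zeta>hom: "\<zeta> \<in> module_hom ?Z (component R A d) (Qp_mod_Zp p)" and \<zeta>inj: "inj_on \<zeta> (A d)"
    using \<zeta> by (auto simp: module_iso_def bij_betw_def)
  have sharp: "bij_betw (zeta_sharp R A \<zeta> k) (A (d - k)) (carrier (pontrjagin_dual p (component R A k)))" for k
    using dual by (auto simp: pontrjagin_self_dual_def module_iso_def)
  have mult: "a \<otimes>\<^bsub>R\<^esub> b \<in> A d" if "a \<in> A (d - k)" "b \<in> A k" for a b k
    using R.mult_degree[OF that] by simp
  show ?thesis
  proof unfold_locales
    fix k \<psi> assume \<psi>: "\<psi> \<in> module_hom ?Z (component R A k) (component R A d)"
    have "(\<lambda>b \<in> A k. \<zeta> (\<psi> b)) \<in> carrier (pontrjagin_dual p (component R A k))"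
    proof -
      interpret C: module ?Z "component R A k" by (rule component_module[OF alg])
      have "(\<lambda>b \<in> A k. \<zeta> (\<psi> b)) \<in> module_hom ?Z (component R A k) (Qp_mod_Zp p)"
        using \<zeta>hom \<psi> C.M.a_closed C.smult_closed unfolding module_hom_simps by simp
      then show ?thesis by (simp add: pontrjagin_dual_def)
    qed
    then obtain a where a: "a \<in> A (d - k)" "zeta_sharp R A \<zeta> k a = (\<lambda>b \<in> A k. \<zeta> (\<psi> b))"
      using sharp[of k] unfolding bij_betw_def by (metis (no_types, lifting) imageE)
    have "a \<otimes>\<^bsub>R\<^esub> b = \<psi> b" if b: "b \<in> A k" for b
    proof (rule inj_onD[OF \<zeta>inj])
      show "\<zeta> (a \<otimes>\<^bsub>R\<^esub> b) = \<zeta> (\<psi> b)" using fun_cong[OF a(2), of b] b by (simp add: zeta_sharp_def)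
      show "a \<otimes>\<^bsub>R\<^esub> b \<in> A d" using a(1) b by (rule mult)
      show "\<psi> b \<in> A d" using \<psi> b by (simp add: module_hom_simps)
    qed
    then show "\<exists>a \<in> A (d - k). \<forall>b \<in> A k. a \<otimes>\<^bsub>R\<^esub> b = \<psi> b" using a(1) by blast
  next
    fix a k assume a: "a \<in> A (d - k)" and zero: "\<And>b. b \<in> A k \<Longrightarrow> a \<otimes>\<^bsub>R\<^esub> b = \<zero>\<^bsub>R\<^esub>"
    have "zeta_sharp R A \<zeta> k a = zeta_sharp R A \<zeta> k \<zero>\<^bsub>R\<^esub>"
      using zero carr unfolding zeta_sharp_def by (intro restrict_ext) (simp add: R.l_null)
    moreover have "\<zero>\<^bsub>R\<^esub> \<in> A (d - k)"
      by (rule additive_subgroup.zero_closed[OF grading_component[OF R.K.M.abelian_group_axioms R.grading]])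
    ultimately show "a = \<zero>\<^bsub>R\<^esub>"
      using inj_onD[OF bij_betw_imp_inj_on[OF sharp]] a by blast
  qed
qed

theorem proposition1p8:
  fixes p :: nat and R :: "(padic_int, 'a) module" and A :: "int \<Rightarrow> 'a set"
    and d :: int and \<zeta> :: "'a \<Rightarrow> (padic_int \<times> padic_int) set set"
  assumes "prime p"
    and "graded_commutative_algebra (padic_integers p) R A"
    and "\<zeta> \<in> module_iso (padic_integers p) (component R A d) (Qp_mod_Zp p)"
    and "pontrjagin_self_dual p R A d \<zeta>"
  shows "self_injective TYPE('l) TYPE('m) R A"
proof (rule perfect_graded_algebra.self_injective)
  let ?Z = "padic_integers p"
  show "perfect_graded_algebra ?Z R A d" using assms(2-4) by (rule self_dual_perfect)
  show "\<exists>a \<in> carrier ?Z. I = PIdl\<^bsub>?Z\<^esub> a" if "ideal I ?Z" for I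
    using assms(1) that by (rule padic_ideal_principal)
  \<comment> \<open>The degree \<open>d\<close> part is divisible because \<open>\<zeta>\<close> identifies it with \<open>\<rat>\<^sub>p/\<int>\<^sub>p\<close>.\<close>
  fix c t assume c: "c \<in> carrier ?Z - {\<zero>\<^bsub>?Z\<^esub>}" and t: "t \<in> A d"
  interpret C: module ?Z "component R A d" by (rule component_module[OF assms(2)])
  have hom: "\<zeta> \<in> module_hom ?Z (component R A d) (Qp_mod_Zp p)" and bij: "bij_betw \<zeta> (A d) (carrier (Qp_mod_Zp p))"
    using assms(3) by (auto simp: module_iso_def)
  have "\<zeta> t \<in> carrier (Qp_mod_Zp p)" using hom t by (simp add: module_hom_simps)
  then obtain u where u: "u \<in> carrier (Qp_mod_Zp p)" "c \<odot>\<^bsub>Qp_mod_Zp p\<^esub> u = \<zeta> t"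
    using Qp_mod_Zp_divisible[OF padic_domain[OF assms(1)] c] by blast
  obtain s where s: "s \<in> A d" "u = \<zeta> s" using u(1) bij by (auto simp: bij_betw_def)
  have "\<zeta> (c \<odot>\<^bsub>R\<^esub> s) = \<zeta> t" using hom c s u(2) by (simp add: module_hom_simps)
  moreover have "c \<odot>\<^bsub>R\<^esub> s \<in> A d" using C.smult_closed[of c s] c s(1) by simp
  ultimately have "c \<odot>\<^bsub>R\<^esub> s = t" using bij t by (auto simp: bij_betw_def dest: inj_onD)
  then show "\<exists>s \<in> A d. c \<odot>\<^bsub>R\<^esub> s = t" using s(1) by blast
qed

end
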